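(* Let $\xi$ be a nonnegative random variable with a nondegenerate distribution, and let $\hat N(t)$ be the associated decoupled renewal process. Let $b\in(0,1)$. Assume that $\mathbb{P}\{\xi>t\}\sim t^{-\alpha}\ell(t)$ as $t\to\infty$ for some $\alpha>1$ and some function $\ell$ slowly varying at $\infty$. Then $$\lim_{t\to\infty}\frac{-\log \mathbb{P}\{\hat N(t)=\lfloor b\mu^{-1}t\rfloor \}}{t\log t}=\frac{(\alpha-1)(1-b)}{\mu},$$ where $\mu=\mathbb{E}[\xi]<\infty$.
   Context: Decoupled renewal process: let $\xi_1,\xi_2,\ldots$ be independent copies of $\xi$ and $S_n=\xi_1+\ldots+\xi_n$, $n\ge 1$. Let $\hat S_1,\hat S_2,\ldots$ be independent random variables such that, for each $n\geq 1$, $\hat S_n$ has the same distribution as $S_n$. Put $\hat N(t):=\sum_{n\geq 1}\mathbf{1}_{\{\hat S_n\leq t\}}$ for $t\geq 0$. Notation: $f(t)\sim g(t)$ as $t\to\infty$ means $\lim_{t\to\infty} f(t)/g(t)=1$. *)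

theory Defs
  imports "HOL-Probability.Probability" "HOL-Library.Landau_Symbols"
begin

text \<open>
  Only eventual positivity is required, and no measurability. In the theorem
  \<open>L\<close> is determined up to asymptotic equivalence by a tail probability, so adding
  measurability to the definition would not change the result.
\<close>
definition slowly_varying :: "(real \<Rightarrow> real) \<Rightarrow> bool" where
  "slowly_varying L \<longleftrightarrow>
     (\<forall>\<^sub>F t in at_top. L t > 0) \<and>
     (\<forall>c>0. ((\<lambda>t. L (c * t) / L t) \<longlongrightarrow> 1) at_top)"

text \<open>
  The sequence is indexed from 1, hence the \<open>Suc\<close>. The values are extended nonnegative
  reals because the number of indices counted may be infinite on a null set.
\<close>
definition counting_process :: "(nat \<Rightarrow> 'a \<Rightarrow> real) \<Rightarrow> real \<Rightarrow> 'a \<Rightarrow> ennreal" where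
  "counting_process T t \<omega> = (\<Sum>n. indicator {..t} (T (Suc n) \<omega>))"

end

theory Submission
  imports Defs "HOL-Real_Asymp.Real_Asymp"
begin

text \<open>
  The indicators of \<open>S_hat n \<le> t\<close> are independent with success probabilities \<open>P(S n \<le> t)\<close>, which
  switch from nearly \<open>1\<close> to exponentially small around \<open>n = t / \<mu>\<close>. In order that only about
  \<open>b t / \<mu>\<close> of them succeed, about \<open>(1 - b) t / \<mu>\<close> of the indices below \<open>t / \<mu>\<close> must have
  \<open>S_hat n > t\<close>. Each such event has probability \<open>t powr (- (\<alpha> - 1) + o(1))\<close>, since the cheapest way
  for \<open>S n\<close> with \<open>n\<close> proportional to \<open>t\<close> to exceed \<open>t\<close> is that one of the \<open>n\<close> summands does. The
  choice of the failing indices costs at most a factor \<open>2 powr (t / \<mu>)\<close>, which is negligible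
  against \<open>exp (t ln t)\<close>.
\<close>

section \<open>Power-like tails\<close>

text \<open>On the scale \<open>t * ln t\<close> tail exponents matter only up to an arbitrary
  \<epsilon>, and factors exponential in t are free. Hence slow variation enters only through
  positivity and the ratio of values at \<open>2 * t\<close> and t, and the lower bound may give
  away a factor 1/2 per succeeding index. The obstacle is uniformity: the deviation estimates must
  hold for all relevant indices at once, while the variance may be infinite. Quadratic Chernoff
  estimates are therefore replaced by a moment of order \<gamma> with 1 < \<gamma> \<le> 2 and
  \<gamma> < \<alpha>, combined with truncation. The lower bound needs more than the failures below
  \<open>t / \<mu>\<close>: the indices up to about \<open>b t / \<mu>\<close> must succeed, and the
  infinitely many later ones must all fail. Beyond \<open>(1 + \<epsilon>) t / \<mu>\<close> the
  success probabilities lie below a geometric series, so those failures together cost only a bounded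
  factor. Between \<open>t / \<mu>\<close> and \<open>(1 + \<epsilon>) t / \<mu>\<close> the crude
  power bound is still used; the loss vanishes with \<epsilon>.\<close>

lemma doubling_bound_above:
  fixes F :: "real \<Rightarrow> real"
  assumes anti: "antimono F" and nonneg: "\<And>t. F t \<ge> 0" and T: "T > 0" and \<beta>: "\<beta> \<ge> 0"
    and dbl: "\<And>t. t \<ge> T \<Longrightarrow> F (2 * t) \<le> 2 powr (- \<beta>) * F t"
    and t: "t \<ge> T"
  shows "F t \<le> F T * (2 * T) powr \<beta> * t powr (- \<beta>)"
proof -
  define C where "C = F T * (2 * T) powr \<beta>"
  \<comment> \<open>Induction over dyadic scales. On \<open>[T, 2 T]\<close> monotonicity gives
    \<open>F t \<le> F T\<close>, and the factor \<open>(2 * T) powr \<beta>\<close> in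
    \<open>C\<close> compensates \<open>t powr (- \<beta>)\<close>; afterwards each halving of t
    gains exactly \<open>2 powr (- \<beta>)\<close>.\<close>
  have *: "\<forall>t. T \<le> t \<and> t \<le> 2 ^ Suc j * T \<longrightarrow> F t \<le> C * t powr (- \<beta>)" for j
  proof (induction j)
    case 0
    show ?case
    proof (intro allI impI)
      fix t assume t: "T \<le> t \<and> t \<le> 2 ^ Suc 0 * T"
      have "1 \<le> ((2 * T) / t) powr \<beta>"
        using t T \<beta> by (intro ge_one_powr_ge_zero) (auto simp: field_simps)
      also have "\<dots> = (2 * T) powr \<beta> * t powr (- \<beta>)"
        using t T by (simp add: powr_divide powr_minus_divide)
      finally have "F T * 1 \<le> F T * ((2 * T) powr \<beta> * t powr (- \<beta>))"
        using nonneg by (intro mult_left_mono)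
      moreover have "F t \<le> F T" using anti t by (simp add: antimonoD)
      ultimately show "F t \<le> C * t powr (- \<beta>)" by (simp add: C_def mult_ac)
    qed
  next
    case (Suc j)
    show ?case
    proof (intro allI impI)
      fix t assume t: "T \<le> t \<and> t \<le> 2 ^ Suc (Suc j) * T"
      show "F t \<le> C * t powr (- \<beta>)"
      proof (cases "t \<le> 2 * T")
        case True
        then have "t \<le> 2 ^ Suc j * T"
          using T order.trans[of t "2 * T" "2 ^ Suc j * T"] by simp
        then show ?thesis using Suc t by blast
      next
        case False
        have "F t = F (2 * (t / 2))" by simp
        also have "\<dots> \<le> 2 powr (- \<beta>) * F (t / 2)"
          using False by (intro dbl) simp
        also have "\<dots> \<le> 2 powr (- \<beta>) * (C * (t / 2) powr (- \<beta>))"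
          using False t by (intro mult_left_mono Suc[rule_format]) auto
        also have "\<dots> = C * t powr (- \<beta>)"
          using False T by (simp add: powr_divide)
        finally show ?thesis .
      qed
    qed
  qed
  obtain j where "t / T < 2 ^ j" using real_arch_pow[of 2 "t / T"] by auto
  then have "t \<le> 2 ^ Suc j * T" using T t by (simp add: field_simps)
  with *[of j] t show ?thesis by (auto simp: C_def)
qed

lemma doubling_bound_below:
  fixes F :: "real \<Rightarrow> real"
  assumes anti: "antimono F" and nonneg: "\<And>t. F t \<ge> 0" and T: "T > 0" and \<beta>: "\<beta> \<ge> 0"
    and dbl: "\<And>t. t \<ge> T \<Longrightarrow> F (2 * t) \<ge> 2 powr (- \<beta>) * F t"
    and t: "t \<ge> T"
  shows "F t \<ge> F (2 * T) * T powr \<beta> * t powr (- \<beta>)"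
proof -
  \<comment> \<open>On the first dyadic interval the smallest value of \<open>F\<close> is
    \<open>F (2 * T)\<close>, and \<open>T powr \<beta> * t powr (- \<beta>)\<close> is at most
    1.\<close>
  define C where "C = F (2 * T) * T powr \<beta>"
  have *: "\<forall>t. T \<le> t \<and> t \<le> 2 ^ Suc j * T \<longrightarrow> F t \<ge> C * t powr (- \<beta>)" for j
  proof (induction j)
    case 0
    show ?case
    proof (intro allI impI)
      fix t assume t: "T \<le> t \<and> t \<le> 2 ^ Suc 0 * T"
      have "T powr \<beta> * t powr (- \<beta>) = (T / t) powr \<beta>"
        using t T by (simp add: powr_divide powr_minus_divide)
      also have "\<dots> \<le> 1"
        using t T \<beta> by (intro powr_le1) (auto simp: field_simps)
      finally have "F (2 * T) * (T powr \<beta> * t powr (- \<beta>)) \<le> F (2 * T) * 1"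
        using nonneg by (intro mult_left_mono)
      moreover have "F (2 * T) \<le> F t" using anti t by (simp add: antimonoD)
      ultimately show "F t \<ge> C * t powr (- \<beta>)" by (simp add: C_def mult_ac)
    qed
  next
    case (Suc j)
    show ?case
    proof (intro allI impI)
      fix t assume t: "T \<le> t \<and> t \<le> 2 ^ Suc (Suc j) * T"
      show "F t \<ge> C * t powr (- \<beta>)"
      proof (cases "t \<le> 2 * T")
        case True
        then have "t \<le> 2 ^ Suc j * T"
          using T order.trans[of t "2 * T" "2 ^ Suc j * T"] by simp
        then show ?thesis using Suc t by blast
      next
        case False
        have "C * t powr (- \<beta>) = 2 powr (- \<beta>) * (C * (t / 2) powr (- \<beta>))"
          using False T by (simp add: powr_divide)
        also have "\<dots> \<le> 2 powr (- \<beta>) * F (t / 2)"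
          using False t by (intro mult_left_mono Suc[rule_format]) auto
        also have "\<dots> \<le> F (2 * (t / 2))"
          using False by (intro dbl) simp
        finally show ?thesis by simp
      qed
    qed
  qed
  obtain j where "t / T < 2 ^ j" using real_arch_pow[of 2 "t / T"] by auto
  then have "t \<le> 2 ^ Suc j * T" using T t by (simp add: field_simps)
  with *[of j] t show ?thesis by (auto simp: C_def)
qed

text \<open>What is kept of regular variation: given monotonicity, the limiting ratio along a single
  doubling fixes the decay exponent up to an arbitrarily small error, so the slowly varying factor
  can be forgotten.\<close>

locale power_tail =
  fixes F :: "real \<Rightarrow> real" and \<alpha> :: real
  assumes anti: "antimono F" and nonneg: "\<And>t. F t \<ge> 0"
    and pos: "eventually (\<lambda>t. F t > 0) at_top"
    and \<alpha>: "\<alpha> > 0"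
    and doubling: "((\<lambda>t. F (2 * t) / F t) \<longlongrightarrow> 2 powr (- \<alpha>)) at_top"
begin

lemma eventually_le:
  assumes "\<beta> < \<alpha>"
  shows "eventually (\<lambda>t. F t \<le> t powr (- \<beta>)) at_top"
proof -
  \<comment> \<open>The gap between \<gamma> and \<alpha> yields the doubling inequality, the gap
    between \<beta> and \<gamma> absorbs the constant \<open>C\<close>. The \<open>max\<close> keeps
    \<gamma> nonnegative when \<beta> is negative.\<close>
  define \<gamma> where "\<gamma> = (\<alpha> + max \<beta> 0) / 2"
  have \<gamma>: "\<beta> < \<gamma>" "\<gamma> < \<alpha>" "\<gamma> \<ge> 0" using assms \<alpha> by (auto simp: \<gamma>_def max_def)
  have "eventually (\<lambda>t. F (2 * t) / F t < 2 powr (- \<gamma>)) at_top"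
    using \<gamma> by (intro order_tendstoD(2)[OF doubling]) simp
  with pos have "eventually (\<lambda>t. F (2 * t) \<le> 2 powr (- \<gamma>) * F t) at_top"
    by eventually_elim (simp add: field_simps)
  then obtain T0 where T0: "\<And>t. t \<ge> T0 \<Longrightarrow> F (2 * t) \<le> 2 powr (- \<gamma>) * F t"
    by (auto simp: eventually_at_top_linorder)
  define T where "T = max T0 1"
  define C where "C = F T * (2 * T) powr \<gamma>"
  have "eventually (\<lambda>t. F t \<le> C * t powr (- \<gamma>)) at_top"
    using eventually_ge_at_top[of T]
    by eventually_elim
      (unfold C_def, rule doubling_bound_above, use anti nonneg T0 \<gamma> in \<open>auto simp: T_def\<close>)
  moreover have "((\<lambda>t. C * t powr (\<beta> - \<gamma>)) \<longlongrightarrow> 0) at_top"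
    using \<gamma> by (auto intro!: tendsto_mult_right_zero tendsto_neg_powr filterlim_ident)
  then have "eventually (\<lambda>t. C * t powr (\<beta> - \<gamma>) < 1) at_top"
    by (rule order_tendstoD) simp
  ultimately show ?thesis
    using eventually_gt_at_top[of 0]
  proof eventually_elim
    case (elim t)
    have "C * t powr (- \<gamma>) = C * t powr (\<beta> - \<gamma>) * t powr (- \<beta>)"
      using elim by (simp flip: powr_add)
    also have "\<dots> \<le> 1 * t powr (- \<beta>)"
      using elim by (intro mult_right_mono) auto
    finally show ?case using elim by simp
  qed
qed

lemma eventually_ge:
  assumes "\<beta> > \<alpha>"
  shows "eventually (\<lambda>t. F t \<ge> t powr (- \<beta>)) at_top"
proof -
  define \<gamma> where "\<gamma> = (\<alpha> + \<beta>) / 2"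
  have \<gamma>: "\<beta> > \<gamma>" "\<gamma> > \<alpha>" "\<gamma> \<ge> 0" using assms \<alpha> by (auto simp: \<gamma>_def max_def)
  have "eventually (\<lambda>t. F (2 * t) / F t > 2 powr (- \<gamma>)) at_top"
    using \<gamma> by (intro order_tendstoD(1)[OF doubling]) simp
  with pos have "eventually (\<lambda>t. F t > 0 \<and> F (2 * t) \<ge> 2 powr (- \<gamma>) * F t) at_top"
    by eventually_elim (simp add: field_simps)
  then obtain T0 where T0: "\<And>t. t \<ge> T0 \<Longrightarrow> F (2 * t) \<ge> 2 powr (- \<gamma>) * F t"
      and F: "\<And>t. t \<ge> T0 \<Longrightarrow> F t > 0"
    by (auto simp: eventually_at_top_linorder)
  define T where "T = max T0 1"
  define C where "C = F (2 * T) * T powr \<gamma>"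
  have "F (2 * T) > 0" "T > 0" by (auto intro!: F simp: T_def max_def)
  then have C: "C > 0" by (auto simp: C_def)
  have "eventually (\<lambda>t. F t \<ge> C * t powr (- \<gamma>)) at_top"
    using eventually_ge_at_top[of T]
    by eventually_elim
      (unfold C_def, rule doubling_bound_below, use anti nonneg T0 \<gamma> in \<open>auto simp: T_def\<close>)
  moreover have "((\<lambda>t. t powr (\<gamma> - \<beta>)) \<longlongrightarrow> 0) at_top"
    using \<gamma> by (auto intro!: tendsto_neg_powr filterlim_ident)
  then have "eventually (\<lambda>t. t powr (\<gamma> - \<beta>) < C) at_top"
    using C by (rule order_tendstoD)
  ultimately show ?thesis
    using eventually_gt_at_top[of 0]
  proof eventually_elim
    case (elim t)
    have "t powr (- \<beta>) = t powr (\<gamma> - \<beta>) * t powr (- \<gamma>)"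
      using elim by (simp flip: powr_add)
    also have "\<dots> \<le> C * t powr (- \<gamma>)"
      using elim by (intro mult_right_mono) auto
    finally show ?case using elim by simp
  qed
qed

end

lemma slowly_varying_imp_power_tail:
  assumes "antimono F" and nonneg: "\<And>t. F t \<ge> 0" and "\<alpha> > 0"
    and sv: "slowly_varying L" and F: "F \<sim>[at_top] (\<lambda>t. t powr (- \<alpha>) * L t)"
  shows "power_tail F \<alpha>"
proof
  have L: "eventually (\<lambda>t. L t > 0) at_top" "((\<lambda>t. L (2 * t) / L t) \<longlongrightarrow> 1) at_top"
    using sv by (auto simp: slowly_varying_def)
  show "eventually (\<lambda>t. F t > 0) at_top"
    \<comment> \<open>Equivalent functions eventually vanish at the same points, so \<open>F\<close>
      is nonzero, and nonnegativity makes it positive.\<close>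
    using asymp_equiv_eventually_zeros[OF F] L(1) eventually_gt_at_top[of 0]
    by eventually_elim (use nonneg in \<open>auto simp: order_less_le\<close>)
  have "filterlim (\<lambda>t::real. 2 * t) at_top at_top" by real_asymp
  from asymp_equiv_compose'[OF F this]
  have "(\<lambda>t. F (2 * t) / F t) \<sim>[at_top]
     (\<lambda>t. ((2 * t) powr (- \<alpha>) * L (2 * t)) / (t powr (- \<alpha>) * L t))"
    by (intro asymp_equiv_intros F)
  moreover have "((\<lambda>t. ((2 * t) powr (- \<alpha>) * L (2 * t)) / (t powr (- \<alpha>) * L t)) \<longlongrightarrow> 2 powr (- \<alpha>)) at_top"
  proof (rule Lim_transform_eventually)
    show "((\<lambda>t. 2 powr (- \<alpha>) * (L (2 * t) / L t)) \<longlongrightarrow> 2 powr (- \<alpha>)) at_top"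
      using tendsto_mult[OF tendsto_const L(2), of "2 powr (- \<alpha>)"] by simp
    show "eventually (\<lambda>t. 2 powr (- \<alpha>) * (L (2 * t) / L t) =
        ((2 * t) powr (- \<alpha>) * L (2 * t)) / (t powr (- \<alpha>) * L t)) at_top"
      using eventually_gt_at_top[of 0] by eventually_elim (simp add: powr_mult)
  qed
  ultimately show "((\<lambda>t. F (2 * t) / F t) \<longlongrightarrow> 2 powr (- \<alpha>)) at_top"
    using tendsto_asymp_equiv_cong by blast
qed (use assms in auto)

section \<open>Chernoff bounds for nonnegative i.i.d. sums\<close>

lemma square_le_powr:
  fixes u \<gamma> :: real
  assumes "0 \<le> u" "u \<le> 1" "\<gamma> \<le> 2"
  shows "u\<^sup>2 \<le> u powr \<gamma>"
proof (cases "u = 0")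
  case False
  then have "u powr 2 \<le> u powr \<gamma>" using assms by (intro powr_mono') auto
  then show ?thesis using assms False by simp
qed simp

text \<open>Replaces the second-order Taylor bound when only a moment of order \<gamma> is finite.
  For u at most 1, multiply \<open>1 - u \<le> exp (- u)\<close> by \<open>1 + u\<close> and use
  \<open>u\<^sup>2 \<le> u powr \<gamma>\<close>; for larger u the last term alone dominates
  \<open>exp u\<close>.\<close>

lemma exp_le_one_plus_powr:
  fixes u \<gamma> :: real
  assumes "u \<ge> 0" "1 \<le> \<gamma>" "\<gamma> \<le> 2"
  shows "exp u \<le> 1 + u + u powr \<gamma> * exp u"
proof (cases "u \<le> 1")
  case True
  have "u\<^sup>2 \<le> u powr \<gamma>" using assms True by (intro square_le_powr)
  have "(1 + u) * (1 - u) \<le> (1 + u) * exp (- u)"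
    using assms exp_ge_add_one_self[of "- u"] by (intro mult_left_mono) auto
  then have "1 \<le> (1 + u) * exp (- u) + u\<^sup>2" by (simp add: power2_eq_square algebra_simps)
  also have "\<dots> \<le> (1 + u) * exp (- u) + u powr \<gamma>" using \<open>u\<^sup>2 \<le> u powr \<gamma>\<close> by simp
  finally have "1 * exp u \<le> ((1 + u) * exp (- u) + u powr \<gamma>) * exp u"
    by (intro mult_right_mono) auto
  then show ?thesis by (simp add: algebra_simps exp_minus)
next
  case False
  then have "1 * exp u \<le> u powr \<gamma> * exp u"
    using assms by (intro mult_right_mono ge_one_powr_ge_zero) auto
  then show ?thesis using assms by linarith
qed

text \<open>For u at most 1 the factorisation
  \<open>1 + u ^ 3 = (1 - u + u\<^sup>2) * (1 + u)\<close> shows that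
  \<open>(1 - u + u\<^sup>2) * exp u\<close> is at least 1; for larger u already
  \<open>u \<le> u powr \<gamma>\<close> suffices.\<close>

lemma exp_minus_le_powr:
  fixes u \<gamma> :: real
  assumes "u \<ge> 0" "1 \<le> \<gamma>" "\<gamma> \<le> 2"
  shows "exp (- u) \<le> 1 - u + u powr \<gamma>"
proof (cases "u \<le> 1")
  case True
  have "u\<^sup>2 \<le> u powr \<gamma>" using assms True by (intro square_le_powr)
  have "0 \<le> 1 - u + u\<^sup>2" using True by simp
  have "1 \<le> 1 + u ^ 3" using assms by simp
  also have "\<dots> = (1 - u + u\<^sup>2) * (1 + u)" by (simp add: power2_eq_square power3_eq_cube algebra_simps)
  also have "\<dots> \<le> (1 - u + u\<^sup>2) * exp u"
    using \<open>0 \<le> 1 - u + u\<^sup>2\<close> by (intro mult_left_mono exp_ge_add_one_self)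
  finally have "1 * exp (- u) \<le> (1 - u + u\<^sup>2) * exp u * exp (- u)"
    by (intro mult_right_mono) auto
  then show ?thesis using \<open>u\<^sup>2 \<le> u powr \<gamma>\<close> by (simp add: mult.assoc flip: exp_add)
next
  case False
  then have "u \<le> u powr \<gamma>" using assms powr_mono[of 1 \<gamma> u] by simp
  moreover have "exp (- u) \<le> 1" using assms by simp
  ultimately show ?thesis by linarith
qed

text \<open>The range of \<xi> is cut into dyadic layers; layer j contributes at most a fixed
  multiple of \<open>2 powr ((\<gamma> - \<beta>) * j)\<close>, a convergent geometric
  series.\<close>

lemma (in prob_space) integrable_powr_of_tail:
  assumes [measurable]: "random_variable borel \<xi>" and nonneg: "AE \<omega> in M. \<xi> \<omega> \<ge> 0"
    and tail: "eventually (\<lambda>t. prob {\<omega> \<in> space M. \<xi> \<omega> > t} \<le> t powr (- \<beta>)) at_top"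
    and \<gamma>: "0 < \<gamma>" "\<gamma> < \<beta>"
  shows "integrable M (\<lambda>\<omega>. \<xi> \<omega> powr \<gamma>)"
proof -
  obtain T where T: "\<And>t. t \<ge> T \<Longrightarrow> prob {\<omega> \<in> space M. \<xi> \<omega> > t} \<le> t powr (- \<beta>)"
    using tail by (auto simp: eventually_at_top_linorder)
  \<comment> \<open>From \<open>2 ^ J\<close> on the tail bound holds at every dyadic point.
    \<open>c j\<close> bounds the power on the layer from \<open>2 ^ (J + j)\<close> to
    \<open>2 ^ (J + j + 1)\<close>, and \<open>C\<close> bounds it below all layers.\<close>
  obtain J where "T < 2 ^ J" using real_arch_pow[of 2 T] by auto
  define c where "c j = (2 ^ (J + j + 1) :: real) powr \<gamma>" for j
  define C where "C = (2 ^ J :: real) powr \<gamma>"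
  have pw: "ennreal (x powr \<gamma>) \<le> ennreal C + (\<Sum>j. ennreal (c j) * indicator {2 ^ (J + j)<..} x)"
    if "x \<ge> 0" for x :: real
  proof (cases "x \<le> 2 ^ J")
    case True
    then have "x powr \<gamma> \<le> C" using that \<gamma> by (auto simp: C_def intro!: powr_mono2)
    then show ?thesis by (auto intro!: add_increasing2 ennreal_leI)
  next
    case False
    define n where "n = (LEAST n. x \<le> 2 ^ n)"
    obtain n0 where "x < 2 ^ n0" using real_arch_pow[of 2 x] by auto
    then have n: "x \<le> 2 ^ n" unfolding n_def using LeastI[of "\<lambda>n. x \<le> 2 ^ n" n0] by simp
    have "J < n"
    proof (rule ccontr)
      assume "\<not> J < n"
      then have "(2::real) ^ n \<le> 2 ^ J" by (intro power_increasing) auto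
      with n False show False by simp
    qed
    define j where "j = n - J - 1"
    have j: "n = J + j + 1" using \<open>J < n\<close> by (simp add: j_def)
    have "\<not> x \<le> 2 ^ (J + j)"
      using not_less_Least[of "J + j" "\<lambda>n. x \<le> 2 ^ n"] j by (simp add: n_def)
    then have "ennreal (x powr \<gamma>) \<le> (\<Sum>j\<in>{j}. ennreal (c j) * indicator {2 ^ (J + j)<..} x)"
      using n j that \<gamma> by (auto simp: c_def intro!: ennreal_leI powr_mono2)
    also have "\<dots> \<le> (\<Sum>j. ennreal (c j) * indicator {2 ^ (J + j)<..} x)"
      by (intro sum_le_suminf) auto
    finally show ?thesis by (simp add: add_increasing)
  qed
  have summand: "c j * (2 ^ (J + j)) powr (- \<beta>) = 2 powr (\<gamma> + J * (\<gamma> - \<beta>)) * (2 powr (\<gamma> - \<beta>)) ^ j" for j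
  proof -
    have pow2: "(2 ^ k :: real) = 2 powr real k" for k by (simp add: powr_realpow)
    have "c j * (2 ^ (J + j)) powr (- \<beta>) = 2 powr (real (J + j + 1) * \<gamma>) * 2 powr (- (real (J + j) * \<beta>))"
      unfolding c_def pow2 powr_powr by simp
    also have "\<dots> = 2 powr (\<gamma> + J * (\<gamma> - \<beta>) + (\<gamma> - \<beta>) * j)"
      by (simp flip: powr_add add: algebra_simps)
    also have "\<dots> = 2 powr (\<gamma> + J * (\<gamma> - \<beta>)) * (2 powr (\<gamma> - \<beta>)) powr real j"
      by (simp only: powr_add powr_powr)
    finally show ?thesis by (subst (asm) powr_realpow) auto
  qed
  have "2 powr (\<gamma> - \<beta>) < (1::real)" using \<gamma> by (intro powr_less_one) auto
  then have summ: "summable (\<lambda>j. c j * (2 ^ (J + j)) powr (- \<beta>))"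
    unfolding summand by (intro summable_mult summable_geometric) simp
  have "(\<integral>\<^sup>+\<omega>. ennreal (\<xi> \<omega> powr \<gamma>) \<partial>M)
      \<le> (\<integral>\<^sup>+\<omega>. ennreal C + (\<Sum>j. ennreal (c j) * indicator {2 ^ (J + j)<..} (\<xi> \<omega>)) \<partial>M)"
    using nonneg by (intro nn_integral_mono_AE) (auto intro: pw)
  also have "\<dots> = ennreal C + (\<Sum>j. ennreal (c j) * (\<integral>\<^sup>+\<omega>. indicator {2 ^ (J + j)<..} (\<xi> \<omega>) \<partial>M))"
    by (simp add: nn_integral_add nn_integral_suminf nn_integral_cmult emeasure_space_1)
  also have "(\<lambda>j. \<integral>\<^sup>+\<omega>. indicator {2 ^ (J + j)<..} (\<xi> \<omega>) \<partial>M) = (\<lambda>j. ennreal (prob {\<omega> \<in> space M. \<xi> \<omega> > 2 ^ (J + j)}))"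
  proof
    fix j
    have "(\<integral>\<^sup>+\<omega>. indicator {2 ^ (J + j)<..} (\<xi> \<omega>) \<partial>M) = (\<integral>\<^sup>+\<omega>. indicator {\<omega> \<in> space M. \<xi> \<omega> > 2 ^ (J + j)} \<omega> \<partial>M)"
      by (intro nn_integral_cong) (auto split: split_indicator)
    then show "(\<integral>\<^sup>+\<omega>. indicator {2 ^ (J + j)<..} (\<xi> \<omega>) \<partial>M) = ennreal (prob {\<omega> \<in> space M. \<xi> \<omega> > 2 ^ (J + j)})"
      by (simp add: emeasure_eq_measure)
  qed
  also have "(\<Sum>j. ennreal (c j) * ennreal (prob {\<omega> \<in> space M. \<xi> \<omega> > 2 ^ (J + j)}))
      \<le> (\<Sum>j. ennreal (c j * (2 ^ (J + j)) powr (- \<beta>)))"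
  proof (intro suminf_le)
    fix j
    have "T \<le> 2 ^ (J + j)"
      using \<open>T < 2 ^ J\<close> power_increasing[of J "J + j" "2::real"] by linarith
    then show "ennreal (c j) * ennreal (prob {\<omega> \<in> space M. \<xi> \<omega> > 2 ^ (J + j)})
        \<le> ennreal (c j * (2 ^ (J + j)) powr (- \<beta>))"
      by (auto simp flip: ennreal_mult simp: c_def intro!: ennreal_leI mult_left_mono T)
  qed auto
  also have "\<dots> = ennreal (\<Sum>j. c j * (2 ^ (J + j)) powr (- \<beta>))"
    using summ by (intro suminf_ennreal2) (auto simp: c_def)
  also have "ennreal C + ennreal (\<Sum>j. c j * (2 ^ (J + j)) powr (- \<beta>)) < \<infinity>"
    by (simp add: less_top[symmetric])
  finally have "(\<integral>\<^sup>+\<omega>. ennreal (\<xi> \<omega> powr \<gamma>) \<partial>M) < \<infinity>"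
    by (simp add: add_left_mono)
  then show ?thesis by (intro integrableI_nonneg) auto
qed

locale iid_nonneg = prob_space +
  fixes \<xi> :: "'a \<Rightarrow> real" and X :: "nat \<Rightarrow> 'a \<Rightarrow> real"
  assumes rv [measurable]: "random_variable borel \<xi>"
    and nonneg: "AE \<omega> in M. \<xi> \<omega> \<ge> 0"
    and indep: "indep_vars (\<lambda>_. borel) X {1..}"
    and identical: "\<And>i. i \<ge> 1 \<Longrightarrow> distr M borel (X i) = distr M borel \<xi>"
begin

abbreviation tail :: "real \<Rightarrow> real" where
  "tail t \<equiv> prob {\<omega> \<in> space M. \<xi> \<omega> > t}"

lemma rv_X: "i \<ge> 1 \<Longrightarrow> random_variable borel (X i)"
  using indep by (auto simp: indep_vars_def)

lemma AE_X_nonneg: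
  assumes "i \<ge> 1" shows "AE \<omega> in M. X i \<omega> \<ge> 0"
proof -
  have "AE x in distr M borel (X i). x \<ge> 0"
    unfolding identical[OF assms] using nonneg by (subst AE_distr_iff) auto
  then show ?thesis using rv_X[OF assms] by (subst (asm) AE_distr_iff) auto
qed

lemma AE_X_nonneg_all: "AE \<omega> in M. \<forall>i\<in>{1..n}. X i \<omega> \<ge> 0"
  using AE_X_nonneg by (intro AE_finite_allI) auto

lemma prob_X:
  assumes "i \<ge> 1" "A \<in> sets borel"
  shows "prob {\<omega> \<in> space M. X i \<omega> \<in> A} = prob {\<omega> \<in> space M. \<xi> \<omega> \<in> A}"
proof -
  have "measure (distr M borel (X i)) A = measure (distr M borel \<xi>) A"
    using identical[OF assms(1)] by simp
  then show ?thesis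
    using assms rv_X[OF assms(1)] by (simp add: measure_distr vimage_def Int_def conj_commute)
qed

text \<open>Common core of the three estimates for sums: independence turns the expectation of the
  product into a power. The free event \<open>A\<close> allows the bound to be restricted to
  outcomes without large jumps, and \<open>AE\<close> accommodates summands that are nonnegative
  only almost surely.\<close>

lemma markov_prod:
  assumes f [measurable]: "f \<in> borel_measurable borel" and f0: "\<And>x. f x \<ge> 0"
    and int: "integrable M (\<lambda>\<omega>. f (\<xi> \<omega>))"
    and A [measurable]: "A \<in> events" and c: "c > 0"
    and ge: "AE \<omega> in M. \<omega> \<in> A \<longrightarrow> c \<le> (\<Prod>i=1..n. f (X i \<omega>))"
  shows "prob A \<le> expectation (\<lambda>\<omega>. f (\<xi> \<omega>)) ^ n / c"
proof -
  have ind: "indep_vars (\<lambda>_. borel) (\<lambda>i \<omega>. f (X i \<omega>)) {1..n}"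
    by (rule indep_vars_compose2[OF indep_vars_subset[OF indep]]) auto
  have *: "integrable M (\<lambda>\<omega>. f (X i \<omega>)) \<and> expectation (\<lambda>\<omega>. f (X i \<omega>)) = expectation (\<lambda>\<omega>. f (\<xi> \<omega>))"
    if "i \<in> {1..n}" for i
  proof -
    have i: "i \<ge> 1" using that by auto
    note [measurable] = rv_X[OF i]
    have "integrable (distr M borel (X i)) f" "integral\<^sup>L (distr M borel (X i)) f = expectation (\<lambda>\<omega>. f (\<xi> \<omega>))"
      unfolding identical[OF i] using int by (auto simp: integrable_distr_eq integral_distr)
    then show ?thesis by (auto simp: integrable_distr_eq integral_distr)
  qed
  have P: "integrable M (\<lambda>\<omega>. \<Prod>i=1..n. f (X i \<omega>))"
    using * by (intro indep_vars_integrable ind) auto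
  have "expectation (\<lambda>\<omega>. \<Prod>i=1..n. f (X i \<omega>)) = (\<Prod>i=1..n. expectation (\<lambda>\<omega>. f (X i \<omega>)))"
    using * by (intro indep_vars_lebesgue_integral ind) auto
  also have "(\<Prod>i=1..n. expectation (\<lambda>\<omega>. f (X i \<omega>))) = (\<Prod>i=1..n. expectation (\<lambda>\<omega>. f (\<xi> \<omega>)))"
    using * by (intro prod.cong) auto
  finally have E: "expectation (\<lambda>\<omega>. \<Prod>i=1..n. f (X i \<omega>)) = expectation (\<lambda>\<omega>. f (\<xi> \<omega>)) ^ n"
    by simp
  have "c * prob A = expectation (\<lambda>\<omega>. c * indicator A \<omega>)" by simp
  also have "\<dots> \<le> expectation (\<lambda>\<omega>. \<Prod>i=1..n. f (X i \<omega>))"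
    using ge by (intro integral_mono_AE P)
      (auto split: split_indicator intro!: prod_nonneg f0 simp: emeasure_eq_measure)
  finally show ?thesis using E c by (simp add: field_simps)
qed

text \<open>Since the summands are nonnegative, a small sum forces each of them to be small; this is
  \<open>markov_prod\<close> for an indicator.\<close>

lemma prob_sum_le_power:
  "prob {\<omega> \<in> space M. (\<Sum>i=1..n. X i \<omega>) \<le> t} \<le> (1 - tail t) ^ n"
proof -
  note [measurable] = rv_X
  have "prob {\<omega> \<in> space M. (\<Sum>i=1..n. X i \<omega>) \<le> t}
      \<le> expectation (\<lambda>\<omega>. indicator {..t} (\<xi> \<omega>)) ^ n / 1"
  proof (rule markov_prod)
    show "AE \<omega> in M. \<omega> \<in> {\<omega> \<in> space M. (\<Sum>i=1..n. X i \<omega>) \<le> t} \<longrightarrow>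
        1 \<le> (\<Prod>i=1..n. indicator {..t} (X i \<omega>) :: real)"
      using AE_X_nonneg_all[of n]
    proof eventually_elim
      case (elim \<omega>)
      have "X i \<omega> \<le> (\<Sum>i=1..n. X i \<omega>)" if "i \<in> {1..n}" for i
        using elim that by (intro member_le_sum) auto
      then have "(\<Prod>i=1..n. indicator {..t} (X i \<omega>) :: real) = 1" if "(\<Sum>i=1..n. X i \<omega>) \<le> t"
        using that by (intro prod.neutral) (fastforce split: split_indicator)
      then show ?case by simp
    qed
  qed (auto intro!: integrable_const_bound[of _ 1])
  also have "expectation (\<lambda>\<omega>. indicator {..t} (\<xi> \<omega>) :: real) = prob {\<omega> \<in> space M. \<xi> \<omega> \<le> t}"
  proof -
    have "expectation (\<lambda>\<omega>. indicator {..t} (\<xi> \<omega>) :: real) =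
        expectation (indicator {\<omega> \<in> space M. \<xi> \<omega> \<le> t})"
      by (intro Bochner_Integration.integral_cong) (auto split: split_indicator)
    then show ?thesis by simp
  qed
  also have "\<dots> = 1 - tail t"
  proof -
    have "{\<omega> \<in> space M. \<xi> \<omega> > t} = space M - {\<omega> \<in> space M. \<xi> \<omega> \<le> t}" by auto
    then show ?thesis by (simp add: prob_compl)
  qed
  finally show ?thesis by simp
qed

context
  fixes \<gamma> :: real
  assumes \<gamma>: "1 \<le> \<gamma>" "\<gamma> \<le> 2"
    and int: "integrable M \<xi>" and intp: "integrable M (\<lambda>\<omega>. \<xi> \<omega> powr \<gamma>)"
begin

text \<open>A Fuk-Nagaev type bound. Exponential moments of \<xi> may be infinite, so a jump above
  the level y is paid for by a union bound and the rest by a Chernoff bound for truncated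
  variables.\<close>

lemma prob_sum_gt_chernoff:
  assumes "l > 0"
  shows "prob {\<omega> \<in> space M. (\<Sum>i=1..n. X i \<omega>) > t} \<le>
    n * tail y + exp (- (l * t) + n * (l * expectation \<xi> + l powr \<gamma> * exp (l * y) * expectation (\<lambda>\<omega>. \<xi> \<omega> powr \<gamma>)))"
proof -
  note [measurable] = rv_X
  \<comment> \<open>The exponential is set to 0 above y. This makes \<open>f\<close> bounded and
    loses nothing off \<open>U\<close>, where every summand is at most y and the product equals
    \<open>exp (l * S n)\<close>.\<close>
  define f where "f x = exp (l * x) * indicator {..y} x" for x :: real
  have f_meas [measurable]: "f \<in> borel_measurable borel" unfolding f_def by measurable
  have f_int: "integrable M (\<lambda>\<omega>. f (\<xi> \<omega>))"
    using assms by (intro integrable_const_bound[of _ "exp (l * y)"]) (auto simp: f_def split: split_indicator)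
  define E where "E = l * expectation \<xi> + l powr \<gamma> * exp (l * y) * expectation (\<lambda>\<omega>. \<xi> \<omega> powr \<gamma>)"
  define U where "U = (\<Union>i\<in>{1..n}. {\<omega> \<in> space M. X i \<omega> \<in> {y<..}})"
  define A where "A = {\<omega> \<in> space M. (\<Sum>i=1..n. X i \<omega>) > t} - U"
  have [measurable]: "U \<in> events" "A \<in> events" unfolding A_def U_def by measurable
  have Ef: "expectation (\<lambda>\<omega>. f (\<xi> \<omega>)) \<le> exp E"
  proof -
    have "expectation (\<lambda>\<omega>. f (\<xi> \<omega>)) \<le>
        expectation (\<lambda>\<omega>. 1 + l * \<xi> \<omega> + l powr \<gamma> * exp (l * y) * \<xi> \<omega> powr \<gamma>)"
    proof (rule integral_mono_AE)
      show "AE \<omega> in M. f (\<xi> \<omega>) \<le> 1 + l * \<xi> \<omega> + l powr \<gamma> * exp (l * y) * \<xi> \<omega> powr \<gamma>"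
        using nonneg
      proof eventually_elim
        case (elim \<omega>)
        show ?case
        proof (cases "\<xi> \<omega> \<le> y")
          case True
          have "f (\<xi> \<omega>) \<le> 1 + l * \<xi> \<omega> + (l * \<xi> \<omega>) powr \<gamma> * exp (l * \<xi> \<omega>)"
            using True elim assms \<gamma> exp_le_one_plus_powr[of "l * \<xi> \<omega>" \<gamma>] by (auto simp: f_def)
          also have "\<dots> \<le> 1 + l * \<xi> \<omega> + (l * \<xi> \<omega>) powr \<gamma> * exp (l * y)"
            using True assms by (intro add_left_mono mult_left_mono) auto
          finally show ?thesis using elim assms by (simp add: powr_mult mult_ac)
        next
          case False
          then show ?thesis using elim assms by (auto simp: f_def)
        qed
      qed
    qed (use f_int int intp in auto)
    also have "\<dots> = 1 + E" using int intp by (simp add: E_def prob_space)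
    also have "\<dots> \<le> exp E" by (rule exp_ge_add_one_self)
    finally show ?thesis .
  qed
  have "prob A \<le> expectation (\<lambda>\<omega>. f (\<xi> \<omega>)) ^ n / exp (l * t)"
  proof (rule markov_prod)
    show "AE \<omega> in M. \<omega> \<in> A \<longrightarrow> exp (l * t) \<le> (\<Prod>i=1..n. f (X i \<omega>))"
    proof (intro AE_I2 impI)
      fix \<omega> assume "\<omega> \<in> A"
      then have le: "\<And>i. i \<in> {1..n} \<Longrightarrow> X i \<omega> \<le> y" and gt: "(\<Sum>i=1..n. X i \<omega>) > t"
        by (force simp: A_def U_def)+
      have "(\<Prod>i=1..n. f (X i \<omega>)) = exp (l * (\<Sum>i=1..n. X i \<omega>))"
        using le by (simp add: f_def exp_sum sum_distrib_left)
      then show "exp (l * t) \<le> (\<Prod>i=1..n. f (X i \<omega>))" using gt assms by simp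
    qed
  qed (auto simp: f_int, simp add: f_def)
  also have "\<dots> \<le> exp E ^ n / exp (l * t)"
    using Ef by (intro divide_right_mono power_mono) (auto simp: f_def)
  also have "\<dots> = exp (- (l * t) + n * E)"
    by (simp add: exp_add exp_diff exp_minus field_simps flip: exp_of_nat_mult)
  finally have A: "prob A \<le> exp (- (l * t) + n * E)" .
  have "prob U \<le> (\<Sum>i\<in>{1..n}. prob {\<omega> \<in> space M. X i \<omega> \<in> {y<..}})"
    unfolding U_def by (intro finite_measure_subadditive_finite) auto
  also have "\<dots> = (\<Sum>i\<in>{1..n}. tail y)"
    by (intro sum.cong refl) (subst prob_X, auto)
  finally have U: "prob U \<le> n * tail y" by simp
  have "prob {\<omega> \<in> space M. (\<Sum>i=1..n. X i \<omega>) > t} \<le> prob (U \<union> A)"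
    by (intro finite_measure_mono) (auto simp: A_def)
  also have "\<dots> \<le> prob U + prob A" by (intro measure_Un_le) auto
  finally show ?thesis using A U by (simp add: E_def)
qed

text \<open>No truncation occurs for the lower deviation, because
  \<open>exp (- (l * \<xi> \<omega>))\<close> is at most 1 almost surely.\<close>

lemma prob_sum_le_chernoff:
  assumes "l > 0"
  shows "prob {\<omega> \<in> space M. (\<Sum>i=1..n. X i \<omega>) \<le> t} \<le>
    exp (l * t - n * (l * expectation \<xi> - l powr \<gamma> * expectation (\<lambda>\<omega>. \<xi> \<omega> powr \<gamma>)))"
proof -
  note [measurable] = rv_X
  define E where "E = l * expectation \<xi> - l powr \<gamma> * expectation (\<lambda>\<omega>. \<xi> \<omega> powr \<gamma>)"
  have f_int: "integrable M (\<lambda>\<omega>. exp (- (l * \<xi> \<omega>)))"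
    using assms nonneg by (intro integrable_const_bound[of _ 1]) auto
  have "expectation (\<lambda>\<omega>. exp (- (l * \<xi> \<omega>))) \<le>
      expectation (\<lambda>\<omega>. 1 - l * \<xi> \<omega> + l powr \<gamma> * \<xi> \<omega> powr \<gamma>)"
  proof (rule integral_mono_AE)
    show "AE \<omega> in M. exp (- (l * \<xi> \<omega>)) \<le> 1 - l * \<xi> \<omega> + l powr \<gamma> * \<xi> \<omega> powr \<gamma>"
      using nonneg
    proof eventually_elim
      case (elim \<omega>)
      then show ?case using exp_minus_le_powr[of "l * \<xi> \<omega>" \<gamma>] assms \<gamma> by (simp add: powr_mult)
    qed
  qed (use f_int int intp in auto)
  also have "\<dots> = 1 + - E" using int intp by (simp add: E_def prob_space)
  also have "\<dots> \<le> exp (- E)" by (rule exp_ge_add_one_self)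
  finally have Ef: "expectation (\<lambda>\<omega>. exp (- (l * \<xi> \<omega>))) \<le> exp (- E)" .
  have "prob {\<omega> \<in> space M. (\<Sum>i=1..n. X i \<omega>) \<le> t} \<le> expectation (\<lambda>\<omega>. exp (- (l * \<xi> \<omega>))) ^ n / exp (- (l * t))"
  proof (rule markov_prod)
    show "AE \<omega> in M. \<omega> \<in> {\<omega> \<in> space M. (\<Sum>i=1..n. X i \<omega>) \<le> t} \<longrightarrow>
        exp (- (l * t)) \<le> (\<Prod>i=1..n. exp (- (l * X i \<omega>)))"
      using assms by (auto simp: sum_negf simp flip: exp_sum sum_distrib_left)
  qed (auto simp: f_int)
  also have "\<dots> \<le> exp (- E) ^ n / exp (- (l * t))"
    using Ef by (intro divide_right_mono power_mono) auto
  also have "\<dots> = exp (l * t - n * E)"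
    by (simp add: exp_diff exp_minus field_simps flip: exp_of_nat_mult)
  finally show ?thesis by (simp add: E_def)
qed

end

end

section \<open>Large deviations for power-like tails\<close>

locale iid_power_tail = iid_nonneg +
  fixes \<alpha> :: real
  assumes \<alpha>: "\<alpha> > 1" and power_tail: "power_tail tail \<alpha>"
begin

interpretation F: power_tail tail \<alpha> by (rule power_tail)

lemma integrable_powr:
  assumes "0 < \<gamma>" "\<gamma> < \<alpha>"
  shows "integrable M (\<lambda>\<omega>. \<xi> \<omega> powr \<gamma>)"
  by (rule integrable_powr_of_tail[OF rv nonneg F.eventually_le[of "(\<gamma> + \<alpha>) / 2"]]) (use assms in auto)

lemma integrable: "integrable M \<xi>"
proof -
  have "integrable M (\<lambda>\<omega>. \<xi> \<omega> powr 1)" using \<alpha> by (intro integrable_powr) auto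
  moreover have "AE \<omega> in M. \<xi> \<omega> powr 1 = \<xi> \<omega>" using nonneg by eventually_elim auto
  ultimately show ?thesis by (subst (asm) integrable_cong_AE) auto
qed

abbreviation mean :: real where "mean \<equiv> expectation \<xi>"

lemma mean_pos: "mean > 0"
proof -
  obtain t where t: "t > 0" "tail t > 0"
    using eventually_happens[OF eventually_conj[OF F.pos eventually_gt_at_top[of 0]]] by auto
  have "t * tail t = expectation (\<lambda>\<omega>. t * indicator {\<omega> \<in> space M. \<xi> \<omega> > t} \<omega>)" by simp
  also have "\<dots> \<le> mean"
  proof (rule integral_mono_AE)
    show "AE \<omega> in M. t * indicator {\<omega> \<in> space M. \<xi> \<omega> > t} \<omega> \<le> \<xi> \<omega>"
      using nonneg by eventually_elim (auto split: split_indicator)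
  qed (auto simp: integrable emeasure_eq_measure)
  finally show ?thesis using t mult_pos_pos[of t "tail t"] by linarith
qed

lemma exists_moment:
  obtains \<gamma> where "1 < \<gamma>" "\<gamma> \<le> 2" "integrable M (\<lambda>\<omega>. \<xi> \<omega> powr \<gamma>)"
\<comment> \<open>The midpoint of 1 and \<alpha>, capped at 2, stays strictly below
  \<alpha>.\<close>
proof (rule that[of "min ((1 + \<alpha>) / 2) 2"])
  show "integrable M (\<lambda>\<omega>. \<xi> \<omega> powr min ((1 + \<alpha>) / 2) 2)"
    using \<alpha> by (intro integrable_powr) (auto simp: min_def)
qed (use \<alpha> in auto)

text \<open>The exponent drops from \<alpha> to \<open>\<alpha> - 1\<close> because up to
  \<open>t / mean\<close> summands may produce the large jump. The quantifier over n sits inside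
  \<open>eventually\<close> so that one threshold for t serves all indices.\<close>

lemma prob_sum_gt_le:
  assumes \<epsilon>: "\<epsilon> > 0" and \<beta>: "\<beta> > 0" "\<beta> < \<alpha> - 1"
  shows "eventually (\<lambda>t. \<forall>n. n * mean \<le> (1 - \<epsilon>) * t \<longrightarrow>
    prob {\<omega> \<in> space M. (\<Sum>i=1..n. X i \<omega>) > t} \<le> t powr (- \<beta>)) at_top"
proof -
  obtain \<gamma> where \<gamma>: "1 < \<gamma>" "\<gamma> \<le> 2" and mom: "integrable M (\<lambda>\<omega>. \<xi> \<omega> powr \<gamma>)"
    by (rule exists_moment)
  define K where "K = expectation (\<lambda>\<omega>. \<xi> \<omega> powr \<gamma>)"
  \<comment> \<open>Truncate at \<open>\<eta> t\<close> and use the exponential parameter \<open>l = c ln t / t\<close>: the drift contributes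
    \<open>t powr (- \<epsilon> c)\<close>, so \<open>c\<close> is taken large, while \<open>\<eta>\<close> must be so small that \<open>exp (l \<eta> t) = t powr (c \<eta>)\<close>
    does not destroy the decay of \<open>t l powr \<gamma>\<close>.\<close>
  define c where "c = (\<beta> + 1) / \<epsilon>"
  define \<eta> where "\<eta> = (\<gamma> - 1) / (2 * c)"
  \<comment> \<open>Midpoint of \<open>\<beta> + 1\<close> and \<alpha>: after the factor
    \<open>t / mean\<close> from the union bound, \<open>t powr (1 - \<delta>)\<close> still beats
    \<open>t powr (- \<beta>)\<close>.\<close>
  define \<delta> where "\<delta> = (\<beta> + 1 + \<alpha>) / 2"
  \<comment> \<open>The error term beyond the drift in the exponent, for one summand. Multiplied by
    \<open>t / mean\<close> it is of order
    \<open>t powr (- ((\<gamma> - 1) / 2)) * ln t powr \<gamma>\<close>, hence eventually below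
    \<open>ln 2\<close>.\<close>
  define W where "W t = (c * ln t / t) powr \<gamma> * exp (c * ln t / t * (\<eta> * t)) * K" for t
  have pos: "c > 0" "\<eta> > 0" "mean > 0" "K \<ge> 0"
    using \<epsilon> \<beta> \<gamma> mean_pos by (auto simp: c_def \<eta>_def K_def)
  have \<delta>: "\<beta> + 1 < \<delta>" "\<delta> < \<alpha>" using \<beta> by (auto simp: \<delta>_def)
  have "filterlim (\<lambda>t::real. \<eta> * t) at_top at_top" using pos by real_asymp
  from eventually_compose_filterlim[OF F.eventually_le[OF \<delta>(2)] this]
  have e1: "eventually (\<lambda>t. tail (\<eta> * t) \<le> (\<eta> * t) powr (- \<delta>)) at_top" .
  have "((\<lambda>t. \<eta> powr (- \<delta>) / mean * t powr (\<beta> + 1 - \<delta>)) \<longlongrightarrow> 0) at_top"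
    using \<delta> by (intro tendsto_mult_right_zero tendsto_neg_powr filterlim_ident) auto
  then have e2: "eventually (\<lambda>t. \<eta> powr (- \<delta>) / mean * t powr (\<beta> + 1 - \<delta>) < 1 / 2) at_top"
    by (rule order_tendstoD) simp
  have "((\<lambda>t. t powr (- ((\<gamma> - 1) / 2)) * ln t powr \<gamma>) \<longlongrightarrow> 0) at_top"
    using \<gamma> by real_asymp
  then have "((\<lambda>t. c powr \<gamma> * K / mean * (t powr (- ((\<gamma> - 1) / 2)) * ln t powr \<gamma>)) \<longlongrightarrow> 0) at_top"
    by (intro tendsto_mult_right_zero)
  then have e3: "eventually (\<lambda>t. c powr \<gamma> * K / mean * (t powr (- ((\<gamma> - 1) / 2)) * ln t powr \<gamma>) < ln 2) at_top"
    by (rule order_tendstoD) simp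
  show ?thesis
    \<comment> \<open>The target is split into two halves. The exponential part is at most
      \<open>2 * t powr (- \<beta> - 1)\<close>, and t at least 4 turns this into half of
      \<open>t powr (- \<beta>)\<close>; the 1 added to \<beta> in \<open>c\<close> serves this
      purpose.\<close>
    using e1 e2 e3 eventually_ge_at_top[of 4]
  proof eventually_elim
    case (elim t)
    have "ln t > 0" using elim by simp
    have W: "t / mean * W t < ln 2"
    proof -
      have c\<eta>: "c * ln t / t * (\<eta> * t) = (\<gamma> - 1) / 2 * ln t"
        using elim pos by (simp add: \<eta>_def)
      have "W t = c powr \<gamma> * ln t powr \<gamma> * t powr (- \<gamma>) * t powr ((\<gamma> - 1) / 2) * K"
        unfolding W_def c\<eta> using elim pos \<open>ln t > 0\<close>
        by (simp add: powr_divide powr_mult powr_minus_divide) (simp add: powr_def)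
      then have "t / mean * W t =
          c powr \<gamma> * K / mean * ((t powr 1 * t powr (- \<gamma>) * t powr ((\<gamma> - 1) / 2)) * ln t powr \<gamma>)"
        using elim by simp
      also have "t powr 1 * t powr (- \<gamma>) * t powr ((\<gamma> - 1) / 2) = t powr (- ((\<gamma> - 1) / 2))"
        unfolding powr_add[symmetric] by (rule arg_cong[of _ _ "(powr) t"]) (simp add: field_simps)
      finally show ?thesis using elim(3) by (simp only:)
    qed
    show ?case
    proof (intro allI impI)
      fix n :: nat assume n: "n * mean \<le> (1 - \<epsilon>) * t"
      have "n * mean \<le> t"
      proof -
        have "(1 - \<epsilon>) * t \<le> 1 * t" using \<epsilon> elim by (intro mult_right_mono) auto
        with n show ?thesis by simp
      qed
      then have n': "n \<le> t / mean" using pos by (simp add: field_simps)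
      have "n * tail (\<eta> * t) \<le> t / mean * (\<eta> * t) powr (- \<delta>)"
        using elim n' by (intro mult_mono) auto
      also have "\<dots> = \<eta> powr (- \<delta>) / mean * (t powr 1 * t powr (- \<delta>))"
        using elim pos by (simp add: powr_mult)
      also have "t powr 1 * t powr (- \<delta>) = t powr (\<beta> + 1 - \<delta>) * t powr (- \<beta>)"
        unfolding powr_add[symmetric] by simp
      also have "\<eta> powr (- \<delta>) / mean * (t powr (\<beta> + 1 - \<delta>) * t powr (- \<beta>)) \<le> 1 / 2 * t powr (- \<beta>)"
        unfolding mult.assoc[symmetric] using elim by (intro mult_right_mono) auto
      finally have A: "n * tail (\<eta> * t) \<le> 1 / 2 * t powr (- \<beta>)" .
      define l where "l = c * ln t / t"
      have l: "l > 0" "l * t = c * ln t" using \<open>ln t > 0\<close> pos elim by (auto simp: l_def)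
      have "n * W t \<le> t / mean * W t"
        using n' pos by (intro mult_right_mono) (auto simp: W_def)
      with W have "n * W t \<le> ln 2" by simp
      moreover have "l * (n * mean) \<le> l * ((1 - \<epsilon>) * t)"
        using l by (intro mult_left_mono[OF n]) simp
      then have "n * (l * mean) \<le> (1 - \<epsilon>) * (c * ln t)"
        unfolding l(2)[symmetric] by (simp add: mult_ac)
      ultimately have "- (l * t) + n * (l * mean + W t) \<le> - (l * t) + ((1 - \<epsilon>) * (c * ln t) + ln 2)"
        by (simp add: distrib_left)
      also have "\<dots> = - (\<epsilon> * c) * ln t + ln 2"
        using l by (simp add: algebra_simps)
      also have "\<epsilon> * c = \<beta> + 1" using \<epsilon> by (simp add: c_def)
      finally have "exp (- (l * t) + n * (l * mean + W t)) \<le> exp (- (\<beta> + 1) * ln t + ln 2)"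
        by simp
      also have "\<dots> = exp ((- \<beta> - 1) * ln t) * exp (ln 2)"
        unfolding exp_add[symmetric] by (simp add: algebra_simps)
      also have "\<dots> = 2 * t powr (- \<beta> - 1)"
        using elim by (simp add: powr_def)
      also have "\<dots> = 2 * t powr (- \<beta>) / t"
        using elim by (simp add: powr_diff)
      also have "\<dots> \<le> 2 * t powr (- \<beta>) / 4"
        using elim by (intro divide_left_mono) auto
      finally have B: "exp (- (l * t) + n * (l * mean + W t)) \<le> 1 / 2 * t powr (- \<beta>)" by simp
      have "prob {\<omega> \<in> space M. (\<Sum>i=1..n. X i \<omega>) > t} \<le>
          n * tail (\<eta> * t) + exp (- (l * t) + n * (l * mean + W t))"
        using prob_sum_gt_chernoff[OF _ _ integrable mom, of l t n "\<eta> * t"] \<gamma> l(1)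
        by (simp add: W_def l_def K_def)
      with A B show "prob {\<omega> \<in> space M. (\<Sum>i=1..n. X i \<omega>) > t} \<le> t powr (- \<beta>)" by simp
    qed
  qed
qed

lemma prob_sum_le_exp:
  assumes \<epsilon>: "\<epsilon> > 0"
  obtains c where "c > 0" "\<And>n t. (1 + \<epsilon>) * t \<le> n * mean \<Longrightarrow>
    prob {\<omega> \<in> space M. (\<Sum>i=1..n. X i \<omega>) \<le> t} \<le> exp (- c * n)"
proof -
  obtain \<gamma> where \<gamma>: "1 < \<gamma>" "\<gamma> \<le> 2" and mom: "integrable M (\<lambda>\<omega>. \<xi> \<omega> powr \<gamma>)"
    by (rule exists_moment)
  define K where "K = expectation (\<lambda>\<omega>. \<xi> \<omega> powr \<gamma>)"
  \<comment> \<open>Chosen so that \<open>mean - 2 * d = mean / (1 + \<epsilon>)\<close>. One d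
    absorbs the error term for small l, the other remains as the rate \<open>l * d\<close>.\<close>
  define d where "d = mean * \<epsilon> / (2 * (1 + \<epsilon>))"
  have d: "d > 0" using mean_pos \<epsilon> by (simp add: d_def)
  have "((\<lambda>l. l powr (\<gamma> - 1)) \<longlongrightarrow> 0) (at_right (0::real))"
    using \<gamma> by real_asymp
  then have "((\<lambda>l. K * l powr (\<gamma> - 1)) \<longlongrightarrow> 0) (at_right 0)"
    by (intro tendsto_mult_right_zero)
  then have "eventually (\<lambda>l. K * l powr (\<gamma> - 1) < d) (at_right 0)"
    using d by (rule order_tendstoD)
  then have "eventually (\<lambda>l. K * l powr (\<gamma> - 1) < d \<and> l > 0) (at_right 0)"
    using eventually_at_right_less[of 0] by eventually_elim auto
  then obtain l where l: "K * l powr (\<gamma> - 1) < d" "l > 0"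
    using eventually_happens[of _ "at_right (0::real)"] by auto
  show thesis
  proof (rule that[of "l * d"])
    fix n :: nat and t :: real assume n: "(1 + \<epsilon>) * t \<le> n * mean"
    have "t \<le> n * mean / (1 + \<epsilon>)" using n \<epsilon> by (simp add: field_simps)
    also have "\<dots> = n * (mean - 2 * d)" using \<epsilon> by (simp add: d_def field_simps)
    finally have "l * t \<le> l * (n * (mean - 2 * d))" using l by (intro mult_left_mono) auto
    moreover have "l powr \<gamma> * K = l * (K * l powr (\<gamma> - 1))"
      using l by (simp add: powr_diff)
    then have "l powr \<gamma> * K \<le> l * d" using l by (metis less_imp_le mult_left_mono)
    then have "n * (l powr \<gamma> * K) \<le> n * (l * d)" by (intro mult_left_mono) auto
    ultimately have "l * t - n * (l * mean - l powr \<gamma> * K) \<le> - (l * d) * n"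
      by (simp add: algebra_simps)
    then have "exp (l * t - n * (l * mean - l powr \<gamma> * K)) \<le> exp (- (l * d) * n)" by simp
    moreover have "prob {\<omega> \<in> space M. (\<Sum>i=1..n. X i \<omega>) \<le> t}
        \<le> exp (l * t - n * (l * mean - l powr \<gamma> * K))"
      using prob_sum_le_chernoff[OF _ _ integrable mom, of l n t] \<gamma> l by (simp add: K_def)
    ultimately show "prob {\<omega> \<in> space M. (\<Sum>i=1..n. X i \<omega>) \<le> t} \<le> exp (- (l * d) * n)" by linarith
  qed (use l d in auto)
qed

text \<open>One summand above t is enough, and \<open>n * tail t\<close> is at least of order
  \<open>t powr (1 - \<delta>)\<close> for any \<delta> > \<alpha>. Nothing bounds n from above, so
  indices near and beyond \<open>t / mean\<close> are covered too.\<close>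

lemma prob_sum_gt_ge:
  assumes a: "a > 0" and \<beta>: "\<beta> > \<alpha> - 1"
  shows "eventually (\<lambda>t. \<forall>n. a * t \<le> n \<longrightarrow>
    prob {\<omega> \<in> space M. (\<Sum>i=1..n. X i \<omega>) > t} \<ge> t powr (- \<beta>)) at_top"
proof -
  note [measurable] = rv_X
  define \<delta> where "\<delta> = (\<beta> + 1 + \<alpha>) / 2"
  have \<delta>: "\<beta> + 1 > \<delta>" "\<delta> > \<alpha>" using \<beta> by (auto simp: \<delta>_def)
  have "((\<lambda>t. a * t powr (1 - \<delta>)) \<longlongrightarrow> 0) at_top"
    using \<delta> \<alpha> by (auto intro!: tendsto_mult_right_zero tendsto_neg_powr filterlim_ident)
  then have e1: "eventually (\<lambda>t. a * t powr (1 - \<delta>) < 1) at_top"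
    by (rule order_tendstoD) simp
  have "((\<lambda>t. t powr (\<delta> - 1 - \<beta>)) \<longlongrightarrow> 0) at_top"
    using \<delta> by (auto intro!: tendsto_neg_powr filterlim_ident)
  then have e2: "eventually (\<lambda>t. t powr (\<delta> - 1 - \<beta>) < a / 2) at_top"
    by (rule order_tendstoD) (use a in simp)
  show ?thesis
    using e1 e2 F.eventually_ge[OF \<delta>(2)] eventually_gt_at_top[of 0]
  proof eventually_elim
    case (elim t)
    show ?case
    proof (intro allI impI)
      fix n :: nat assume n: "a * t \<le> n"
      \<comment> \<open>A lower bound for \<open>n * tail t\<close> that is below 1, so that
        \<open>1 - exp (- x)\<close> is still at least \<open>x / 2\<close>.\<close>
      define x where "x = a * t powr (1 - \<delta>)"
      have x: "x > 0" "x < 1" using elim a by (auto simp: x_def)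
      have "x = a * t * t powr (- \<delta>)"
        using elim by (simp add: x_def powr_diff powr_minus_divide)
      also have "\<dots> \<le> n * tail t" using n elim by (intro mult_mono) auto
      finally have xn: "x \<le> n * tail t" .
      have "prob {\<omega> \<in> space M. (\<Sum>i=1..n. X i \<omega>) \<le> t} \<le> (1 - tail t) ^ n"
        by (rule prob_sum_le_power)
      also have "\<dots> \<le> exp (- tail t) ^ n"
        using exp_ge_add_one_self[of "- tail t"] by (intro power_mono) auto
      also have "\<dots> = exp (- (n * tail t))" by (simp flip: exp_of_nat_mult)
      also have "\<dots> \<le> exp (- x)" using xn by simp
      also have "\<dots> \<le> 1 / (1 + x)"
        using x exp_ge_add_one_self[of x] by (simp add: exp_minus field_simps)
      finally have "prob {\<omega> \<in> space M. (\<Sum>i=1..n. X i \<omega>) \<le> t} \<le> 1 / (1 + x)" .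
      moreover have "prob {\<omega> \<in> space M. (\<Sum>i=1..n. X i \<omega>) > t} =
          1 - prob {\<omega> \<in> space M. (\<Sum>i=1..n. X i \<omega>) \<le> t}"
      proof -
        have "{\<omega> \<in> space M. (\<Sum>i=1..n. X i \<omega>) > t} = space M - {\<omega> \<in> space M. (\<Sum>i=1..n. X i \<omega>) \<le> t}"
          by auto
        then show ?thesis by (simp add: prob_compl)
      qed
      moreover have "1 - 1 / (1 + x) \<ge> x / 2"
      proof -
        have "x * x \<le> x * 1" using x by (intro mult_left_mono) auto
        then show ?thesis using x by (simp add: field_simps)
      qed
      moreover have "t powr (- \<beta>) \<le> x / 2"
      proof -
        have "t powr (- \<beta>) = t powr (\<delta> - 1 - \<beta>) * t powr (1 - \<delta>)"
          unfolding powr_add[symmetric] by simp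
        also have "\<dots> \<le> a / 2 * t powr (1 - \<delta>)" using elim by (intro mult_right_mono) auto
        finally show ?thesis by (simp add: x_def)
      qed
      ultimately show "prob {\<omega> \<in> space M. (\<Sum>i=1..n. X i \<omega>) > t} \<ge> t powr (- \<beta>)" by linarith
    qed
  qed
qed

end

section \<open>Counting independent events\<close>

lemma card_gt_of_counting_process_eq:
  fixes k m :: nat
  assumes "counting_process T t \<omega> = of_nat k"
  shows "m - k \<le> card {n \<in> {1..m}. T n \<omega> > t}"
proof -
  define A where "A = {n \<in> {1..m}. T n \<omega> \<le> t}"
  have "(of_nat (card A) :: ennreal) = (\<Sum>n\<in>{1..m}. indicator {..t} (T n \<omega>))"
    unfolding card_eq_sum A_def of_nat_sum
    by (subst sum.inter_filter) (auto intro!: sum.cong)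
  also have "\<dots> = (\<Sum>n<m. indicator {..t} (T (Suc n) \<omega>))"
    by (rule sum.reindex_bij_witness[of _ Suc "\<lambda>n. n - 1"]) auto
  also have "\<dots> \<le> of_nat k"
    unfolding assms[symmetric] counting_process_def by (intro sum_le_suminf) auto
  finally have "card A \<le> k" by simp
  moreover have "card ({1..m} - A) = m - card A"
    by (subst card_Diff_subset) (auto simp: A_def)
  moreover have "{1..m} - A = {n \<in> {1..m}. T n \<omega> > t}" by (auto simp: A_def)
  ultimately show ?thesis by simp
qed

lemma counting_process_eq:
  assumes "\<And>n. n \<ge> 1 \<Longrightarrow> n \<le> k \<Longrightarrow> T n \<omega> \<le> t" and "\<And>n. n > k \<Longrightarrow> T n \<omega> > t"
  shows "counting_process T t \<omega> = of_nat k"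
proof -
  have "counting_process T t \<omega> = (\<Sum>n\<in>{..<k}. indicator {..t} (T (Suc n) \<omega>))"
    unfolding counting_process_def
  proof (rule suminf_finite)
    fix n assume "n \<notin> {..<k}"
    then have "T (Suc n) \<omega> > t" by (intro assms(2)) simp
    then show "indicator {..t} (T (Suc n) \<omega>) = (0 :: ennreal)" by simp
  qed simp
  also have "\<dots> = (\<Sum>n\<in>{..<k}. 1)"
    using assms(1) by (intro sum.cong) (auto split: split_indicator)
  finally show ?thesis by simp
qed

locale indep_times = prob_space +
  fixes Z :: "nat \<Rightarrow> 'a \<Rightarrow> real"
  assumes indep_Z: "indep_vars (\<lambda>_. borel) Z {1..}"
begin

lemma rv_Z: "n \<ge> 1 \<Longrightarrow> random_variable borel (Z n)"
  using indep_Z by (auto simp: indep_vars_def)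

lemma events_counting: "{\<omega> \<in> space M. counting_process Z t \<omega> = of_nat k} \<in> events"
proof -
  have [measurable]: "random_variable borel (Z (Suc n))" for n by (rule rv_Z) simp
  show ?thesis unfolding counting_process_def by measurable
qed

lemma events_Ball_Z:
  assumes "finite B" "B \<subseteq> {1..}" "\<And>n. n \<in> B \<Longrightarrow> A n \<in> sets borel"
  shows "{\<omega> \<in> space M. \<forall>n\<in>B. Z n \<omega> \<in> A n} \<in> events"
proof (rule sets.sets_Collect_finite_All[OF _ assms(1)])
  fix n assume n: "n \<in> B"
  have "Z n -` A n \<inter> space M \<in> events"
    using n assms by (intro measurable_sets[OF rv_Z]) auto
  moreover have "Z n -` A n \<inter> space M = {\<omega> \<in> space M. Z n \<omega> \<in> A n}" by auto
  ultimately show "{\<omega> \<in> space M. Z n \<omega> \<in> A n} \<in> events" by simp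
qed

lemma prob_Ball_Z:
  assumes "finite B" "B \<subseteq> {1..}" "\<And>n. n \<in> B \<Longrightarrow> A n \<in> sets borel"
  shows "prob {\<omega> \<in> space M. \<forall>n\<in>B. Z n \<omega> \<in> A n} = (\<Prod>n\<in>B. prob {\<omega> \<in> space M. Z n \<omega> \<in> A n})"
\<comment> \<open>The empty family is separate: an empty intersection would be the whole type
  instead of \<open>space M\<close>.\<close>
proof (cases "B = {}")
  case False
  have "{\<omega> \<in> space M. \<forall>n\<in>B. Z n \<omega> \<in> A n} = (\<Inter>n\<in>B. Z n -` A n \<inter> space M)"
    using False by auto
  also have "prob \<dots> = (\<Prod>n\<in>B. prob (Z n -` A n \<inter> space M))"
    using False assms by (intro indep_varsD[OF indep_Z]) auto
  also have "\<dots> = (\<Prod>n\<in>B. prob {\<omega> \<in> space M. Z n \<omega> \<in> A n})"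
    by (intro prod.cong refl arg_cong[of _ _ prob]) auto
  finally show ?thesis .
qed (simp add: prob_space)

text \<open>A union bound over the possible sets of failing indices, at most \<open>2 ^ m\<close> of
  them. For \<open>k \<ge> m\<close> the subtraction gives 0 and the bound is trivial.\<close>

lemma prob_counting_le:
  assumes q: "\<And>n. n \<in> {1..m} \<Longrightarrow> prob {\<omega> \<in> space M. Z n \<omega> > t} \<le> q" and "q \<le> 1" "0 \<le> q"
  shows "prob {\<omega> \<in> space M. counting_process Z t \<omega> = of_nat k} \<le> 2 ^ m * q ^ (m - k)"
proof -
  define P where "P = {B \<in> Pow {1..m}. m - k \<le> card B}"
  define E where "E B = {\<omega> \<in> space M. \<forall>n\<in>B. Z n \<omega> \<in> {t<..}}" for B
  have P: "finite P" "card P \<le> 2 ^ m"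
    using card_mono[of "Pow {1..m}" P] by (auto simp: P_def card_Pow)
  have PD: "finite B" "B \<subseteq> {1..m}" "B \<subseteq> {1..}" "m - k \<le> card B" if "B \<in> P" for B
    using that finite_subset[of B "{1..m}"] by (auto simp: P_def)
  have E: "E B \<in> events" if "B \<in> P" for B
    unfolding E_def using PD[OF that] by (intro events_Ball_Z) auto
  have "prob {\<omega> \<in> space M. counting_process Z t \<omega> = of_nat k} \<le> prob (\<Union>B\<in>P. E B)"
  proof (rule finite_measure_mono)
    show "{\<omega> \<in> space M. counting_process Z t \<omega> = of_nat k} \<subseteq> (\<Union>B\<in>P. E B)"
    proof safe
      fix \<omega> assume \<omega>: "\<omega> \<in> space M" "counting_process Z t \<omega> = of_nat k"
      have "{n \<in> {1..m}. Z n \<omega> > t} \<in> P"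
        using card_gt_of_counting_process_eq[OF \<omega>(2), of m] by (auto simp: P_def)
      moreover have "\<omega> \<in> E {n \<in> {1..m}. Z n \<omega> > t}" using \<omega> by (auto simp: E_def)
      ultimately show "\<omega> \<in> (\<Union>B\<in>P. E B)" by blast
    qed
  qed (use P E in auto)
  also have "\<dots> \<le> (\<Sum>B\<in>P. prob (E B))"
    using P E by (intro finite_measure_subadditive_finite) auto
  also have "\<dots> \<le> (\<Sum>B\<in>P. q ^ (m - k))"
  proof (rule sum_mono)
    fix B assume B: "B \<in> P"
    have "prob (E B) = (\<Prod>n\<in>B. prob {\<omega> \<in> space M. Z n \<omega> \<in> {t<..}})"
      unfolding E_def using PD[OF B] by (intro prob_Ball_Z) auto
    also have "\<dots> \<le> (\<Prod>n\<in>B. q)"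
      using PD(2)[OF B] q by (intro prod_mono) auto
    also have "\<dots> \<le> q ^ (m - k)"
      using PD[OF B] assms by (auto intro: power_decreasing)
    finally show "prob (E B) \<le> q ^ (m - k)" .
  qed
  also have "\<dots> = card P * q ^ (m - k)" by simp
  also have "\<dots> \<le> 2 ^ m * q ^ (m - k)"
    using P assms by (intro mult_right_mono) (auto simp flip: of_nat_power simp: of_nat_le_iff)
  finally show ?thesis .
qed

text \<open>A single pattern suffices: the first k indices succeed and all others fail. The
  successes give k factors 1/2, and the additional one in \<open>Suc k\<close> pays for all indices
  beyond m.\<close>

lemma prob_counting_ge:
  assumes km: "k \<le> m" and "q \<ge> 0"
    and p: "\<And>n. n \<in> {1..k} \<Longrightarrow> prob {\<omega> \<in> space M. Z n \<omega> \<le> t} \<ge> 1 / 2"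
    and q: "\<And>n. n \<in> {k<..m} \<Longrightarrow> prob {\<omega> \<in> space M. Z n \<omega> > t} \<ge> q"
    and s: "\<And>N. (\<Sum>n\<in>{m<..N}. prob {\<omega> \<in> space M. Z n \<omega> \<le> t}) \<le> 1 / 2"
  shows "prob {\<omega> \<in> space M. counting_process Z t \<omega> = of_nat k} \<ge> (1 / 2) ^ Suc k * q ^ (m - k)"
proof -
  define A where "A n = (if n \<le> k then {..t} else {t<..})" for n
  have A: "A n \<in> sets borel" for n by (auto simp: A_def)
  define E where "E N = {\<omega> \<in> space M. \<forall>n\<in>{1..N}. Z n \<omega> \<in> A n}" for N
  have E: "E N \<in> events" for N
    unfolding E_def using A by (intro events_Ball_Z) auto
  have "(\<lambda>N. prob (E N)) \<longlonglongrightarrow> prob (\<Inter>N. E N)"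
    using E by (intro finite_Lim_measure_decseq) (auto simp: decseq_def E_def)
  moreover have "prob (E N) \<ge> (1 / 2) ^ Suc k * q ^ (m - k)" if N: "N \<ge> m" for N
  proof -
    define r where "r n = prob {\<omega> \<in> space M. Z n \<omega> \<in> A n}" for n
    have r0: "r n \<ge> 0" for n by (simp add: r_def)
    \<comment> \<open>The Weierstrass product inequality bounds the block beyond m uniformly in N,
      which permits the passage to the infinite intersection.\<close>
    have "1 / 2 \<le> 1 - (\<Sum>n\<in>{m<..N}. prob {\<omega> \<in> space M. Z n \<omega> \<le> t})" using s[of N] by simp
    also have "\<dots> \<le> (\<Prod>n\<in>{m<..N}. 1 - prob {\<omega> \<in> space M. Z n \<omega> \<le> t})"
      by (rule Weierstrass_prod_ineq) auto
    also have "\<dots> = (\<Prod>n\<in>{m<..N}. r n)"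
    proof (rule prod.cong)
      fix n assume n: "n \<in> {m<..N}"
      have [measurable]: "random_variable borel (Z n)" using n by (intro rv_Z) auto
      have "{\<omega> \<in> space M. Z n \<omega> \<in> A n} = space M - {\<omega> \<in> space M. Z n \<omega> \<le> t}"
        using n km by (auto simp: A_def)
      then show "1 - prob {\<omega> \<in> space M. Z n \<omega> \<le> t} = r n" by (simp add: r_def prob_compl)
    qed simp
    finally have P3: "(\<Prod>n\<in>{m<..N}. r n) \<ge> 1 / 2" .
    have "q ^ (m - k) = (\<Prod>n\<in>{k<..m}. q)" by simp
    also have "\<dots> \<le> (\<Prod>n\<in>{k<..m}. r n)"
      using q assms(2) by (intro prod_mono) (auto simp: r_def A_def)
    finally have P2: "(\<Prod>n\<in>{k<..m}. r n) \<ge> q ^ (m - k)" .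
    have "(1 / 2) ^ k = (\<Prod>n\<in>{1..k}. 1 / 2 :: real)" by simp
    also have "\<dots> \<le> (\<Prod>n\<in>{1..k}. r n)"
      using p by (intro prod_mono) (auto simp: r_def A_def)
    finally have P1: "(\<Prod>n\<in>{1..k}. r n) \<ge> (1 / 2) ^ k" .
    have "(1 / 2) ^ Suc k * q ^ (m - k) = (1 / 2) ^ k * q ^ (m - k) * (1 / 2)" by simp
    also have "\<dots> \<le> (\<Prod>n\<in>{1..k}. r n) * (\<Prod>n\<in>{k<..m}. r n) * (\<Prod>n\<in>{m<..N}. r n)"
      using P1 P2 P3 assms(2) by (intro mult_mono mult_nonneg_nonneg prod_nonneg) (auto simp: r0)
    also have "(\<Prod>n\<in>{1..k}. r n) * (\<Prod>n\<in>{k<..m}. r n) = (\<Prod>n\<in>{1..m}. r n)"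
      using km by (subst prod.union_disjoint[symmetric]) (auto intro!: prod.cong)
    also have "(\<Prod>n\<in>{1..m}. r n) * (\<Prod>n\<in>{m<..N}. r n) = (\<Prod>n\<in>{1..N}. r n)"
      using N by (subst prod.union_disjoint[symmetric]) (auto intro!: prod.cong)
    also have "\<dots> = prob (E N)"
      unfolding E_def r_def using A by (intro prob_Ball_Z[symmetric]) auto
    finally show ?thesis .
  qed
  ultimately have "prob (\<Inter>N. E N) \<ge> (1 / 2) ^ Suc k * q ^ (m - k)"
    by (intro LIMSEQ_le_const) auto
  also have "prob (\<Inter>N. E N) \<le> prob {\<omega> \<in> space M. counting_process Z t \<omega> = of_nat k}"
  proof (rule finite_measure_mono[OF _ events_counting], safe)
    fix \<omega> assume \<omega>: "\<omega> \<in> (\<Inter>N. E N)"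
    then show "\<omega> \<in> space M" by (auto simp: E_def)
    have Z: "Z n \<omega> \<in> A n" if "n \<ge> 1" for n
    proof -
      have "\<omega> \<in> E n" using \<omega> by blast
      then show ?thesis using that by (auto simp: E_def)
    qed
    show "counting_process Z t \<omega> = of_nat k"
    proof (rule counting_process_eq)
      show "Z n \<omega> \<le> t" if "n \<ge> 1" "n \<le> k" for n using Z[of n] that by (simp add: A_def)
      show "Z n \<omega> > t" if "n > k" for n using Z[of n] that by (simp add: A_def)
    qed
  qed
  finally show ?thesis .
qed

end

section \<open>The decoupled renewal process\<close>

locale decoupled_renewal = iid_power_tail + indep_times +
  assumes distr_Z: "\<And>n. n \<ge> 1 \<Longrightarrow> distr M borel (Z n) = distr M borel (\<lambda>\<omega>. \<Sum>i=1..n. X i \<omega>)"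
  fixes b :: real
  assumes b: "0 < b" "b < 1"
begin

abbreviation target :: "real \<Rightarrow> nat" where
  "target t \<equiv> nat \<lfloor>b / mean * t\<rfloor>"

abbreviation prob_target :: "real \<Rightarrow> real" where
  "prob_target t \<equiv> prob {\<omega> \<in> space M. counting_process Z t \<omega> = of_nat (target t)}"

lemma prob_Z:
  assumes n: "n \<ge> 1" and A: "A \<in> sets borel"
  shows "prob {\<omega> \<in> space M. Z n \<omega> \<in> A} = prob {\<omega> \<in> space M. (\<Sum>i=1..n. X i \<omega>) \<in> A}"
proof -
  note [measurable] = rv_X
  have "measure (distr M borel (Z n)) A = measure (distr M borel (\<lambda>\<omega>. \<Sum>i=1..n. X i \<omega>)) A"
    using distr_Z[OF n] by simp
  then show ?thesis
    using A rv_Z[OF n] by (simp add: measure_distr vimage_def Int_def conj_commute)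
qed

lemma prob_Z_le:
  "n \<ge> 1 \<Longrightarrow> prob {\<omega> \<in> space M. Z n \<omega> \<le> t} = prob {\<omega> \<in> space M. (\<Sum>i=1..n. X i \<omega>) \<le> t}"
  using prob_Z[of n "{..t}"] by simp

lemma prob_Z_gt:
  "n \<ge> 1 \<Longrightarrow> prob {\<omega> \<in> space M. Z n \<omega> > t} = prob {\<omega> \<in> space M. (\<Sum>i=1..n. X i \<omega>) > t}"
  using prob_Z[of n "{t<..}"] by simp

lemma prob_target_le:
  assumes \<epsilon>: "0 < \<epsilon>" "\<epsilon> < 1 - b" "\<epsilon> < \<alpha> - 1"
  shows "eventually (\<lambda>t. prob_target t \<le>
    2 powr (t / mean) * t powr (- ((\<alpha> - 1 - \<epsilon>) * ((1 - \<epsilon> - b) * t / mean - 1)))) at_top"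
proof -
  have "eventually (\<lambda>t. \<forall>n. n * mean \<le> (1 - \<epsilon>) * t \<longrightarrow>
      prob {\<omega> \<in> space M. (\<Sum>i=1..n. X i \<omega>) > t} \<le> t powr (- (\<alpha> - 1 - \<epsilon>))) at_top"
    using \<epsilon> by (intro prob_sum_gt_le) auto
  then show ?thesis
    using eventually_ge_at_top[of 1]
  proof eventually_elim
    case (elim t)
    define q where "q = t powr (- (\<alpha> - 1 - \<epsilon>))"
    define m where "m = nat \<lfloor>(1 - \<epsilon>) * t / mean\<rfloor>"
    have "(1 - \<epsilon>) * t / mean \<ge> 0" "b / mean * t \<ge> 0"
      using elim \<epsilon> b mean_pos by auto
    then have m: "real m \<le> (1 - \<epsilon>) * t / mean" "real m \<ge> (1 - \<epsilon>) * t / mean - 1"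
        and k: "real (target t) \<le> b / mean * t"
      by (auto simp: m_def)
    have "(1 - \<epsilon>) * t / mean \<le> 1 * t / mean"
      using elim \<epsilon> mean_pos by (intro divide_right_mono mult_right_mono) auto
    with m have m': "real m \<le> t / mean" by simp
    have q: "0 \<le> q" "q \<le> 1"
      using elim \<epsilon> powr_mono[of "- (\<alpha> - 1 - \<epsilon>)" 0 t] by (auto simp: q_def)
    have "prob_target t \<le> 2 ^ m * q ^ (m - target t)"
    proof (rule prob_counting_le)
      fix n assume n: "n \<in> {1..m}"
      then have "real n \<le> (1 - \<epsilon>) * t / mean" using m by simp
      then have "n * mean \<le> (1 - \<epsilon>) * t" using mean_pos by (simp add: field_simps)
      then show "prob {\<omega> \<in> space M. Z n \<omega> > t} \<le> q"
        using elim n by (subst prob_Z_gt) (auto simp: q_def)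
    qed (use q in auto)
    also have "\<dots> = 2 powr (real m) * t powr (- ((\<alpha> - 1 - \<epsilon>) * real (m - target t)))"
      using elim by (simp add: q_def powr_realpow powr_powr flip: powr_realpow[of "t powr _"]) (simp add: algebra_simps)
    also have "\<dots> \<le> 2 powr (t / mean) * t powr (- ((\<alpha> - 1 - \<epsilon>) * ((1 - \<epsilon> - b) * t / mean - 1)))"
    proof (intro mult_mono powr_mono)
      \<comment> \<open>Only the rounding of \<open>m\<close> costs 1; the floor in
        \<open>target t\<close> acts in the favourable direction.\<close>
      have "(1 - \<epsilon> - b) * t / mean - 1 \<le> real (m - target t)"
        using m k by (simp add: algebra_simps diff_divide_distrib add_divide_distrib)
      then show "- ((\<alpha> - 1 - \<epsilon>) * real (m - target t)) \<le> - ((\<alpha> - 1 - \<epsilon>) * ((1 - \<epsilon> - b) * t / mean - 1))"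
        using \<epsilon> by (simp add: mult_left_mono)
    qed (use elim m' in auto)
    finally show ?case .
  qed
qed

lemma prob_target_ge:
  assumes \<epsilon>: "0 < \<epsilon>"
  shows "eventually (\<lambda>t. prob_target t \<ge>
    2 powr (- (b * t / mean + 1)) * t powr (- ((\<alpha> - 1 + \<epsilon>) * ((1 + \<epsilon> - b) * t / mean + 1)))) at_top"
proof -
  note [measurable] = rv_X
  \<comment> \<open>Any exponent strictly between 0 and \<open>\<alpha> - 1\<close> would do: for
    the early indices it is enough that the failure probability tends to 0.\<close>
  define \<beta> where "\<beta> = (\<alpha> - 1) / 2"
  have \<beta>: "0 < \<beta>" "\<beta> < \<alpha> - 1" using \<alpha> by (auto simp: \<beta>_def)
  \<comment> \<open>With gap \<open>1 - b\<close> the condition reads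
    \<open>n * mean \<le> b * t\<close>, which holds for all indices up to
    \<open>target t\<close>.\<close>
  have e1: "eventually (\<lambda>t. \<forall>n. n * mean \<le> (1 - (1 - b)) * t \<longrightarrow>
      prob {\<omega> \<in> space M. (\<Sum>i=1..n. X i \<omega>) > t} \<le> t powr (- \<beta>)) at_top"
    using b \<beta> by (intro prob_sum_gt_le) auto
  have "((\<lambda>t::real. t powr (- \<beta>)) \<longlongrightarrow> 0) at_top"
    using \<beta> by (intro tendsto_neg_powr filterlim_ident) auto
  then have e2: "eventually (\<lambda>t::real. t powr (- \<beta>) < 1 / 2) at_top"
    by (rule order_tendstoD) simp
  have e3: "eventually (\<lambda>t. \<forall>n. b / mean * t \<le> n \<longrightarrow>
      prob {\<omega> \<in> space M. (\<Sum>i=1..n. X i \<omega>) > t} \<ge> t powr (- (\<alpha> - 1 + \<epsilon>))) at_top"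
    using b mean_pos \<epsilon> by (intro prob_sum_gt_ge) auto
  obtain c where c: "c > 0" "\<And>n t. (1 + \<epsilon>) * t \<le> n * mean \<Longrightarrow>
      prob {\<omega> \<in> space M. (\<Sum>i=1..n. X i \<omega>) \<le> t} \<le> exp (- c * n)"
    by (rule prob_sum_le_exp[OF \<epsilon>]) blast
  have "summable (\<lambda>n. exp (- c) ^ n)" using c by (intro summable_geometric) auto
  \<comment> \<open>The Cauchy criterion for the geometric series: once \<open>m t\<close> passes
    \<open>N0\<close>, the success probabilities beyond it sum to less than 1/2.\<close>
  then obtain N0 where N0: "\<And>m n. m \<ge> N0 \<Longrightarrow> norm (\<Sum>n=m..n. exp (- c) ^ n) < 1 / 2"
    by (rule summable_partial_sum_bound[of _ "1 / 2"]) auto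
  define m where "m t = nat \<lfloor>(1 + \<epsilon>) * t / mean\<rfloor>" for t
  have "filterlim (\<lambda>t. (1 + \<epsilon>) * t / v) at_top at_top" if "v > 0" for v :: real
    using \<epsilon> that by real_asymp
  from this[OF mean_pos] have e4: "eventually (\<lambda>t. (1 + \<epsilon>) * t / mean \<ge> N0) at_top"
    by (simp add: filterlim_at_top)
  show ?thesis
    using e1 e2 e3 e4 eventually_ge_at_top[of 1]
  proof eventually_elim
    case (elim t)
    define q where "q = t powr (- (\<alpha> - 1 + \<epsilon>))"
    have nn: "(1 + \<epsilon>) * t / mean \<ge> 0" "b / mean * t \<ge> 0"
      using elim \<epsilon> b mean_pos by auto
    then have m: "real (m t) \<le> (1 + \<epsilon>) * t / mean"
        and k: "real (target t) \<le> b / mean * t" "real (target t) \<ge> b / mean * t - 1"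
      by (auto simp: m_def)
    have "b * t / mean \<le> (1 + \<epsilon>) * t / mean"
      using b \<epsilon> mean_pos elim by (intro divide_right_mono mult_right_mono) auto
    then have km: "target t \<le> m t" by (auto simp: m_def intro!: nat_mono floor_mono)
    have "N0 \<le> m t" unfolding m_def using elim(4) by (simp add: le_nat_floor)
    have "2 powr (- (b * t / mean + 1)) * t powr (- ((\<alpha> - 1 + \<epsilon>) * ((1 + \<epsilon> - b) * t / mean + 1)))
        \<le> 2 powr (- (real (Suc (target t)))) * t powr (- ((\<alpha> - 1 + \<epsilon>) * real (m t - target t)))"
    proof (intro mult_mono powr_mono)
      have "real (m t - target t) \<le> (1 + \<epsilon> - b) * t / mean + 1"
        using m k km by (simp add: of_nat_diff algebra_simps diff_divide_distrib add_divide_distrib)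
      then show "- ((\<alpha> - 1 + \<epsilon>) * ((1 + \<epsilon> - b) * t / mean + 1)) \<le> - ((\<alpha> - 1 + \<epsilon>) * real (m t - target t))"
        using \<epsilon> \<alpha> by (simp add: mult_left_mono)
    qed (use elim k in auto)
    also have "\<dots> = (1 / 2) ^ Suc (target t) * q ^ (m t - target t)"
    proof -
      have "2 powr (- real j) = (1 / 2 :: real) ^ j" for j :: nat
        by (simp add: powr_minus_divide powr_realpow power_one_over)
      moreover have "t powr (- ((\<alpha> - 1 + \<epsilon>) * real j)) = q ^ j" for j
        using elim by (auto simp: q_def powr_power algebra_simps)
      ultimately show ?thesis by (simp only:)
    qed
    also have "\<dots> \<le> prob_target t"
    proof (rule prob_counting_ge)
      fix n assume n: "n \<in> {1..target t}"
      then have "real n \<le> b / mean * t" using k by simp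
      then have "n * mean \<le> (1 - (1 - b)) * t" using mean_pos by (simp add: field_simps)
      then have "prob {\<omega> \<in> space M. (\<Sum>i=1..n. X i \<omega>) > t} \<le> 1 / 2"
        using elim by fastforce
      moreover have "{\<omega> \<in> space M. (\<Sum>i=1..n. X i \<omega>) > t} = space M - {\<omega> \<in> space M. (\<Sum>i=1..n. X i \<omega>) \<le> t}"
        by auto
      ultimately show "1 / 2 \<le> prob {\<omega> \<in> space M. Z n \<omega> \<le> t}"
        using n by (simp add: prob_Z_le prob_compl)
    next
      fix n assume n: "n \<in> {target t<..m t}"
      then have "b / mean * t \<le> n" using nn by (simp add: nat_less_iff floor_less_iff)
      then show "q \<le> prob {\<omega> \<in> space M. Z n \<omega> > t}"
        using elim n by (subst prob_Z_gt) (auto simp: q_def)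
    next
      fix N
      have "(\<Sum>n\<in>{m t<..N}. prob {\<omega> \<in> space M. Z n \<omega> \<le> t}) \<le> (\<Sum>n=m t..N. exp (- c) ^ n)"
      proof (rule sum_mono2[THEN order.trans[rotated]])
        show "(\<Sum>n\<in>{m t<..N}. prob {\<omega> \<in> space M. Z n \<omega> \<le> t}) \<le> (\<Sum>n\<in>{m t<..N}. exp (- c) ^ n)"
        proof (rule sum_mono)
          fix n assume n: "n \<in> {m t<..N}"
          then have "(1 + \<epsilon>) * t / mean \<le> n" using nn by (simp add: m_def nat_less_iff floor_less_iff)
          then have "(1 + \<epsilon>) * t \<le> n * mean" using mean_pos by (simp add: field_simps)
          from c(2)[OF this] show "prob {\<omega> \<in> space M. Z n \<omega> \<le> t} \<le> exp (- c) ^ n"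
            using n by (simp add: prob_Z_le mult.commute flip: exp_of_nat_mult)
        qed
      qed auto
      also have "\<dots> \<le> 1 / 2" using N0[OF \<open>N0 \<le> m t\<close>, of N] by simp
      finally show "(\<Sum>n\<in>{m t<..N}. prob {\<omega> \<in> space M. Z n \<omega> \<le> t}) \<le> 1 / 2" .
    qed (use km in \<open>auto simp: q_def\<close>)
    finally show ?case .
  qed
qed

text \<open>Ensures that the logarithm is genuine rather than the default value of \<open>ln\<close>
  at 0, and permits its monotonicity to be used.\<close>

lemma prob_target_pos: "eventually (\<lambda>t. prob_target t > 0) at_top"
  using prob_target_ge[OF zero_less_one] eventually_gt_at_top[of 0]
  by eventually_elim (erule less_le_trans[rotated], simp)

text \<open>For a given r on either side of the limit, \<epsilon> is fixed first, by continuity at 0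
  of the perturbed constant. After that the powers of 2 contribute only O(t) and the rounding terms
  only O(ln t), both negligible against \<open>t * ln t\<close>.\<close>

lemma log_prob_target:
  "((\<lambda>t. - ln (prob_target t) / (t * ln t)) \<longlongrightarrow> (\<alpha> - 1) * (1 - b) / mean) at_top"
proof (rule order_tendstoI)
  fix r assume r: "r < (\<alpha> - 1) * (1 - b) / mean"
  have "((\<lambda>\<epsilon>. (\<alpha> - 1 - \<epsilon>) * (1 - \<epsilon> - b) / mean) \<longlongrightarrow> (\<alpha> - 1 - 0) * (1 - 0 - b) / mean) (at_right 0)"
    using mean_pos by (intro tendsto_intros) auto
  then have "eventually (\<lambda>\<epsilon>. (\<alpha> - 1 - \<epsilon>) * (1 - \<epsilon> - b) / mean > r) (at_right 0)"
    using r by (intro order_tendstoD(1)) auto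
  moreover have "eventually (\<lambda>\<epsilon>. \<epsilon> \<in> {0<..<min (1 - b) (\<alpha> - 1)}) (at_right 0)"
    using b \<alpha> by (intro eventually_at_right_real) auto
  ultimately have "eventually (\<lambda>\<epsilon>. (\<alpha> - 1 - \<epsilon>) * (1 - \<epsilon> - b) / mean > r \<and>
      0 < \<epsilon> \<and> \<epsilon> < 1 - b \<and> \<epsilon> < \<alpha> - 1) (at_right 0)"
    by eventually_elim auto
  then obtain \<epsilon> where \<epsilon>: "(\<alpha> - 1 - \<epsilon>) * (1 - \<epsilon> - b) / mean > r" "0 < \<epsilon>" "\<epsilon> < 1 - b" "\<epsilon> < \<alpha> - 1"
    using eventually_happens[of _ "at_right (0::real)"] by auto
  define p u where "p = \<alpha> - 1 - \<epsilon>" and "u = 1 - \<epsilon> - b"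
  have pu: "p > 0" "u > 0" "mean > 0" using \<epsilon> mean_pos by (auto simp: p_def u_def)
  have "((\<lambda>t. (p * (u * t / v - 1) * ln t - t / v * ln 2) / (t * ln t)) \<longlongrightarrow> p * u / v) at_top" if "v > 0" for v :: real
    using that pu by real_asymp (simp add: field_simps)
  from this[OF pu(3)] have "eventually (\<lambda>t. (p * (u * t / mean - 1) * ln t - t / mean * ln 2) / (t * ln t) > r) at_top"
    using \<epsilon>(1) by (intro order_tendstoD(1)) (auto simp: p_def u_def)
  then show "eventually (\<lambda>t. - ln (prob_target t) / (t * ln t) > r) at_top"
    using prob_target_le[OF \<epsilon>(2-4)] prob_target_pos eventually_gt_at_top[of 1]
  proof eventually_elim
    case (elim t)
    have "ln (prob_target t) \<le> ln (2 powr (t / mean) * t powr (- (p * (u * t / mean - 1))))"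
      using elim by (simp add: p_def u_def)
    also have "\<dots> = t / mean * ln 2 - p * (u * t / mean - 1) * ln t"
      using elim by (simp add: ln_mult)
    finally have "(p * (u * t / mean - 1) * ln t - t / mean * ln 2) / (t * ln t)
        \<le> - ln (prob_target t) / (t * ln t)"
      using elim by (intro divide_right_mono) auto
    with elim(1) show ?case by linarith
  qed
next
  fix r assume r: "r > (\<alpha> - 1) * (1 - b) / mean"
  have "((\<lambda>\<epsilon>. (\<alpha> - 1 + \<epsilon>) * (1 + \<epsilon> - b) / mean) \<longlongrightarrow> (\<alpha> - 1 + 0) * (1 + 0 - b) / mean) (at_right 0)"
    using mean_pos by (intro tendsto_intros) auto
  then have "eventually (\<lambda>\<epsilon>. (\<alpha> - 1 + \<epsilon>) * (1 + \<epsilon> - b) / mean < r) (at_right 0)"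
    using r by (intro order_tendstoD(2)) auto
  then have "eventually (\<lambda>\<epsilon>. (\<alpha> - 1 + \<epsilon>) * (1 + \<epsilon> - b) / mean < r \<and> 0 < \<epsilon>) (at_right 0)"
    using eventually_at_right_less[of 0] by eventually_elim auto
  then obtain \<epsilon> where \<epsilon>: "(\<alpha> - 1 + \<epsilon>) * (1 + \<epsilon> - b) / mean < r" "0 < \<epsilon>"
    using eventually_happens[of _ "at_right (0::real)"] by auto
  define p u where "p = \<alpha> - 1 + \<epsilon>" and "u = 1 + \<epsilon> - b"
  have pu: "p > 0" "u > 0" "mean > 0" using \<epsilon> mean_pos \<alpha> b by (auto simp: p_def u_def)
  have "((\<lambda>t. (p * (u * t / v + 1) * ln t + (b * t / v + 1) * ln 2) / (t * ln t)) \<longlongrightarrow> p * u / v) at_top" if "v > 0" for v :: real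
    using that pu b by real_asymp (simp add: field_simps)
  from this[OF pu(3)] have "eventually (\<lambda>t. (p * (u * t / mean + 1) * ln t + (b * t / mean + 1) * ln 2) / (t * ln t) < r) at_top"
    using \<epsilon>(1) by (intro order_tendstoD(2)) (auto simp: p_def u_def)
  then show "eventually (\<lambda>t. - ln (prob_target t) / (t * ln t) < r) at_top"
    using prob_target_ge[OF \<epsilon>(2)] prob_target_pos eventually_gt_at_top[of 1]
  proof eventually_elim
    case (elim t)
    have "- (p * (u * t / mean + 1) * ln t + (b * t / mean + 1) * ln 2) =
        ln (2 powr (- (b * t / mean + 1)) * t powr (- (p * (u * t / mean + 1))))"
      using elim by (simp add: ln_mult) (simp add: algebra_simps)
    also have "\<dots> \<le> ln (prob_target t)"
      using elim by (intro ln_mono) (auto simp: p_def u_def)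
    finally have "- ln (prob_target t) / (t * ln t) \<le>
        (p * (u * t / mean + 1) * ln t + (b * t / mean + 1) * ln 2) / (t * ln t)"
      using elim by (intro divide_right_mono) auto
    with elim(1) show ?case by linarith
  qed
qed

end

theorem theorem2:
  fixes M :: "'a measure"
    and \<xi> :: "'a \<Rightarrow> real"
    and X :: "nat \<Rightarrow> 'a \<Rightarrow> real"
    and S :: "nat \<Rightarrow> 'a \<Rightarrow> real"
    and S_hat :: "nat \<Rightarrow> 'a \<Rightarrow> real"
    and L :: "real \<Rightarrow> real"
    and \<alpha> b \<mu> :: real
  assumes "prob_space M"
    and "\<xi> \<in> borel_measurable M"
    and "AE \<omega> in M. \<xi> \<omega> \<ge> 0"
    and "\<not> (\<exists>c. AE \<omega> in M. \<xi> \<omega> = c)"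
    and "prob_space.indep_vars M (\<lambda>_. borel) X {1..}"
    and "\<And>n. n \<ge> 1 \<Longrightarrow> distr M borel (X n) = distr M borel \<xi>"
    and "\<And>n \<omega>. S n \<omega> = (\<Sum>i=1..n. X i \<omega>)"
    and "prob_space.indep_vars M (\<lambda>_. borel) S_hat {1..}"
    and "\<And>n. n \<ge> 1 \<Longrightarrow> distr M borel (S_hat n) = distr M borel (S n)"
    and "0 < b" "b < 1"
    and "\<alpha> > 1"
    and "slowly_varying L"
    and "(\<lambda>t. measure M {\<omega> \<in> space M. \<xi> \<omega> > t}) \<sim>[at_top] (\<lambda>t. t powr (- \<alpha>) * L t)"
    and "\<mu> = (\<integral>\<omega>. \<xi> \<omega> \<partial>M)"
  shows "integrable M \<xi> \<and>
    (\<forall>\<^sub>F t in at_top.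
       measure M {\<omega> \<in> space M. counting_process S_hat t \<omega> = of_nat (nat \<lfloor>b / \<mu> * t\<rfloor>)} > 0) \<and>
    ((\<lambda>t. - ln (measure M {\<omega> \<in> space M. counting_process S_hat t \<omega> = of_nat (nat \<lfloor>b / \<mu> * t\<rfloor>)})
          / (t * ln t))
       \<longlongrightarrow> (\<alpha> - 1) * (1 - b) / \<mu>) at_top"
proof -
  interpret prob_space M by fact
  note [measurable] = assms(2)
  have S: "S n = (\<lambda>\<omega>. \<Sum>i=1..n. X i \<omega>)" for n using assms(7) by auto
  have "antimono (\<lambda>t. prob {\<omega> \<in> space M. \<xi> \<omega> > t})"
    by (intro antimonoI finite_measure_mono) auto
  then have "power_tail (\<lambda>t. prob {\<omega> \<in> space M. \<xi> \<omega> > t}) \<alpha>"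
    using assms(12) by (intro slowly_varying_imp_power_tail[OF _ _ _ assms(13,14)]) auto
  then interpret F: power_tail "\<lambda>t. prob {\<omega> \<in> space M. \<xi> \<omega> > t}" \<alpha> .
  interpret decoupled_renewal M \<xi> X \<alpha> S_hat b
  proof unfold_locales
    show "distr M borel (S_hat n) = distr M borel (\<lambda>\<omega>. \<Sum>i=1..n. X i \<omega>)" if "n \<ge> 1" for n
      using assms(9)[OF that] by (simp add: S)
  qed (rule assms(2,3,5,6,8,10-12); assumption?)+
  show ?thesis
    unfolding assms(15) using integrable prob_target_pos log_prob_target by blast
qed

end
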